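(* For every multiprojective space $Y=\mathbb{P}^{n_1}\times\cdots\times\mathbb{P}^{n_k}$ (with $k\ge 1$ and all $n_i>0$), the second Terracini locus $\mathbb{T}(Y,2)$ is empty.
   Context: We work over an algebraically closed field $\mathbb{K}$ of characteristic $0$. For $Y=\mathbb{P}^{n_1}\times\cdots\times\mathbb{P}^{n_k}$ let $\pi_i:Y\to\mathbb{P}^{n_i}$ be the $i$-th projection. For $p\in Y$ let $(2p,Y)$ be the closed subscheme of $Y$ with ideal sheaf $(\mathcal{I}_{p,Y})^2$, and for a finite set $S\subset Y$ let $(2S,Y)=\bigcup_{p\in S}(2p,Y)$. Put $\delta(2S,Y):=h^1(Y,\mathcal{I}_{(2S,Y)}(1,\dots,1))$. Let $S(Y,r)$ be the set of all subsets of $Y$ with cardinality $r$. The space $Y$ is the minimal multiprojective space containing $S$ if $\langle\pi_i(S)\rangle=\mathbb{P}^{n_i}$ for all $i$, where all $n_i>0$. Define $$\mathbb{T}_1(Y,r)=\{S\in S(Y,r)\mid h^0(\mathcal{I}_{(2S,Y)}(1,\dots,1))>0\text{ and }\delta(2S,Y)>0\},$$ and the $r$-th Terracini locus $$\mathbb{T}(Y,r)=\{S\in\mathbb{T}_1(Y,r)\mid Y\text{ is the minimal multiprojective space containing }S\}.$$ *)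

theory Defs
  imports
    Complex_Main
    "HOL-Library.FuncSet"
    "HOL-Library.Function_Algebras"
    "HOL-Library.Poly_Mapping"
    "HOL-Library.Extended_Nat"
    "HOL-Computational_Algebra.Polynomial"
begin

text \<open>
  The multiprojective space \<open>Y = P^(n 0) \<times> \<dots> \<times> P^(n (k - 1))\<close> is given by the number \<open>k\<close> of factors
  and the dimensions \<open>n i\<close> for \<open>i < k\<close>. It carries the multihomogeneous coordinates \<open>x (i, j)\<close>
  with \<open>i < k\<close> and \<open>j \<le> n i\<close>.
\<close>

section \<open>Points\<close>

definition vec_scale :: "'a::field \<Rightarrow> (nat \<Rightarrow> 'a) \<Rightarrow> nat \<Rightarrow> 'a" where
  "vec_scale c v = (\<lambda>j. c * v j)"

lemma vector_space_vec_scale: "vector_space (vec_scale :: 'a::field \<Rightarrow> _)"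
  by unfold_locales (auto simp: vec_scale_def fun_eq_iff algebra_simps)

text \<open>\<open>K^(m+1)\<close>, realised as the sequences vanishing beyond index \<open>m\<close>\<close>

definition coord_space :: "nat \<Rightarrow> (nat \<Rightarrow> 'a::field) set" where
  "coord_space m = {v. \<forall>j>m. v j = 0}"

definition proj_rel :: "nat \<Rightarrow> ((nat \<Rightarrow> 'a::field) \<times> (nat \<Rightarrow> 'a)) set" where
  "proj_rel m = {(v, w). v \<in> coord_space m - {0} \<and> w \<in> coord_space m - {0} \<and>
                         (\<exists>c. c \<noteq> 0 \<and> w = vec_scale c v)}"

definition proj_space :: "nat \<Rightarrow> (nat \<Rightarrow> 'a::field) set set" where
  "proj_space m = (coord_space m - {0}) // proj_rel m"

definition proj_span :: "nat \<Rightarrow> (nat \<Rightarrow> 'a::field) set set \<Rightarrow> (nat \<Rightarrow> 'a) set set" where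
  "proj_span m A = {P \<in> proj_space m. P \<subseteq> module.span vec_scale (\<Union>A)}"

type_synonym 'a mpoint = "nat \<Rightarrow> (nat \<Rightarrow> 'a) set"

definition multiproj :: "nat \<Rightarrow> (nat \<Rightarrow> nat) \<Rightarrow> 'a::field mpoint set" where
  "multiproj k n = (\<Pi>\<^sub>E i\<in>{..<k}. proj_space (n i))"

definition multiproj_proj :: "nat \<Rightarrow> 'a mpoint \<Rightarrow> (nat \<Rightarrow> 'a) set" where
  "multiproj_proj i p = p i"

definition minimal_multiproj :: "nat \<Rightarrow> (nat \<Rightarrow> nat) \<Rightarrow> 'a::field mpoint set \<Rightarrow> bool" where
  "minimal_multiproj k n S \<longleftrightarrow>
     (\<forall>i<k. proj_span (n i) (multiproj_proj i ` S) = proj_space (n i))"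

section \<open>Sections of twisted ideal sheaves on the standard affine cover\<close>

text \<open>
  A chart is a choice function \<open>J\<close>; the corresponding open affine subset \<open>U_J\<close> is where
  \<open>x (i, J i) \<noteq> 0\<close> for all \<open>i < k\<close>. For a nonempty set \<open>T\<close> of charts put
  \<open>U_T = (\<Inter>J\<in>T. U_J)\<close>, which is again affine. Sections over \<open>U_T\<close> are Laurent polynomials in the
  \<open>x (i, j)\<close>; restriction to smaller \<open>U_T\<close> is the inclusion, \<open>Y\<close> being integral.
\<close>

definition charts :: "nat \<Rightarrow> (nat \<Rightarrow> nat) \<Rightarrow> (nat \<Rightarrow> nat) set" where
  "charts k n = (\<Pi>\<^sub>E i\<in>{..<k}. {..n i})"

type_synonym 'a laurent = "((nat \<times> nat) \<Rightarrow>\<^sub>0 int) \<Rightarrow>\<^sub>0 'a"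

text \<open>
  \<open>twist_sections k n d T\<close> are the sections over \<open>U_T\<close> of the line bundle of multidegree \<open>(d, \<dots>, d)\<close>:
  the part of that multidegree of the coordinate ring localised at the variables \<open>x (i, J i)\<close>,
  \<open>J \<in> T\<close>. In particular \<open>d = 0\<close> gives the regular functions.
\<close>

definition twist_sections ::
    "nat \<Rightarrow> (nat \<Rightarrow> nat) \<Rightarrow> int \<Rightarrow> (nat \<Rightarrow> nat) set \<Rightarrow> 'a::field laurent set" where
  "twist_sections k n d T =
     {f. \<forall>m \<in> Poly_Mapping.keys f.
           Poly_Mapping.keys m \<subseteq> {(i, j). i < k \<and> j \<le> n i} \<and>
           (\<forall>i<k. (\<Sum>j\<le>n i. Poly_Mapping.lookup m (i, j)) = d) \<and>
           (\<forall>i j. Poly_Mapping.lookup m (i, j) < 0 \<longrightarrow> (\<exists>J\<in>T. j = J i))}"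

definition laurent_eval :: "'a::field laurent \<Rightarrow> (nat \<Rightarrow> nat \<Rightarrow> 'a) \<Rightarrow> 'a" where
  "laurent_eval f x =
     (\<Sum>m\<in>Poly_Mapping.keys f. Poly_Mapping.lookup f m *
        (\<Prod>(i, j)\<in>Poly_Mapping.keys m. x i j powi Poly_Mapping.lookup m (i, j)))"

definition in_open :: "nat \<Rightarrow> (nat \<Rightarrow> nat) set \<Rightarrow> 'a::field mpoint \<Rightarrow> bool" where
  "in_open k T p \<longleftrightarrow> (\<forall>J\<in>T. \<forall>i<k. \<forall>v\<in>p i. v (J i) \<noteq> 0)"

definition vanishes_at :: "nat \<Rightarrow> 'a::field laurent \<Rightarrow> 'a mpoint \<Rightarrow> bool" where
  "vanishes_at k f p \<longleftrightarrow> (\<forall>x. (\<forall>i<k. x i \<in> p i) \<longrightarrow> laurent_eval f x = 0)"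

text \<open>The unit ideal if \<open>p\<close> is not in \<open>U_T\<close>\<close>

definition point_ideal ::
    "nat \<Rightarrow> (nat \<Rightarrow> nat) \<Rightarrow> 'a::field mpoint \<Rightarrow> (nat \<Rightarrow> nat) set \<Rightarrow> 'a laurent set" where
  "point_ideal k n p T = {f \<in> twist_sections k n 0 T. in_open k T p \<longrightarrow> vanishes_at k f p}"

definition module_prod :: "'r::comm_ring_1 set \<Rightarrow> 'r set \<Rightarrow> 'r set" where
  "module_prod A B = {\<Sum>l<(N::nat). a l * b l | N a b. \<forall>l<N. a l \<in> A \<and> b l \<in> B}"

text \<open>The ideal of \<open>(2S, Y)\<close>, the union of the double points \<open>(2p, Y)\<close>, on \<open>U_T\<close>\<close>

definition double_points_ideal ::
    "nat \<Rightarrow> (nat \<Rightarrow> nat) \<Rightarrow> 'a::field mpoint set \<Rightarrow> (nat \<Rightarrow> nat) set \<Rightarrow> 'a laurent set" where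
  "double_points_ideal k n S T =
     {f \<in> twist_sections k n 0 T. \<forall>p\<in>S. f \<in> module_prod (point_ideal k n p T) (point_ideal k n p T)}"

text \<open>Sections over \<open>U_T\<close> of the ideal sheaf of \<open>(2S, Y)\<close> twisted by \<open>(1, \<dots>, 1)\<close>\<close>

definition twisted_ideal ::
    "nat \<Rightarrow> (nat \<Rightarrow> nat) \<Rightarrow> 'a::field mpoint set \<Rightarrow> (nat \<Rightarrow> nat) set \<Rightarrow> 'a laurent set" where
  "twisted_ideal k n S T = module_prod (double_points_ideal k n S T) (twist_sections k n 1 T)"

section \<open>Cohomology\<close>

text \<open>
  The cohomology of a coherent sheaf is the cohomology of its (non-alternating) Cech complex for the
  standard affine cover. The sheaf enters through its sections \<open>F T\<close> over the sets \<open>U_T\<close>.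
  A \<open>q\<close>-cochain assigns to each \<open>(q + 1)\<close>-tuple of charts a section over their intersection; it is
  set to \<open>0\<close> on all other lists.
\<close>

type_synonym 'a cochain = "(nat \<Rightarrow> nat) list \<Rightarrow> 'a laurent"

definition chart_tuples :: "nat \<Rightarrow> (nat \<Rightarrow> nat) \<Rightarrow> nat \<Rightarrow> (nat \<Rightarrow> nat) list set" where
  "chart_tuples k n q = {Js. length Js = q + 1 \<and> set Js \<subseteq> charts k n}"

definition cochains ::
    "nat \<Rightarrow> (nat \<Rightarrow> nat) \<Rightarrow> ((nat \<Rightarrow> nat) set \<Rightarrow> 'a::field laurent set) \<Rightarrow> nat \<Rightarrow> 'a cochain set" where
  "cochains k n F q =
     {c. (\<forall>Js \<in> chart_tuples k n q. c Js \<in> F (set Js)) \<and> (\<forall>Js. Js \<notin> chart_tuples k n q \<longrightarrow> c Js = 0)}"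

definition coboundary ::
    "nat \<Rightarrow> (nat \<Rightarrow> nat) \<Rightarrow> nat \<Rightarrow> 'a::field cochain \<Rightarrow> 'a cochain" where
  "coboundary k n q c =
     (\<lambda>Js. if Js \<in> chart_tuples k n (q + 1)
            then \<Sum>l\<le>q + 1. (- 1) ^ l * c (take l Js @ drop (Suc l) Js) else 0)"

definition cocycles ::
    "nat \<Rightarrow> (nat \<Rightarrow> nat) \<Rightarrow> ((nat \<Rightarrow> nat) set \<Rightarrow> 'a::field laurent set) \<Rightarrow> nat \<Rightarrow> 'a cochain set" where
  "cocycles k n F q = {c \<in> cochains k n F q. coboundary k n q c = 0}"

fun coboundaries ::
    "nat \<Rightarrow> (nat \<Rightarrow> nat) \<Rightarrow> ((nat \<Rightarrow> nat) set \<Rightarrow> 'a::field laurent set) \<Rightarrow> nat \<Rightarrow> 'a cochain set" where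
  "coboundaries k n F 0 = {0}"
| "coboundaries k n F (Suc q) = coboundary k n q ` cochains k n F q"

definition cochain_scale :: "'a::field \<Rightarrow> 'a cochain \<Rightarrow> 'a cochain" where
  "cochain_scale a c = (\<lambda>Js. Poly_Mapping.single 0 a * c Js)"

lemma vector_space_cochain_scale: "vector_space (cochain_scale :: 'a::field \<Rightarrow> _)"
proof
  fix a b :: 'a and x y :: "'a cochain"
  show "cochain_scale a (x + y) = cochain_scale a x + cochain_scale a y"
    by (simp add: cochain_scale_def fun_eq_iff algebra_simps)
  show "cochain_scale (a + b) x = cochain_scale a x + cochain_scale b x"
    by (simp add: cochain_scale_def fun_eq_iff algebra_simps single_add)
  show "cochain_scale a (cochain_scale b x) = cochain_scale (a * b) x"
    by (simp add: cochain_scale_def fun_eq_iff mult.assoc [symmetric] mult_single)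
  show "cochain_scale 1 x = x"
    by (simp add: cochain_scale_def)
qed

text \<open>
  The dimension of the quotient \<open>Z / B\<close> of vector spaces \<open>B \<subseteq> Z\<close>: the supremum of the sizes of finite
  sets of vectors of \<open>Z\<close> whose classes are linearly independent in \<open>Z / B\<close>.
\<close>

definition quotient_dim ::
    "('a::field \<Rightarrow> 'v::ab_group_add \<Rightarrow> 'v) \<Rightarrow> 'v set \<Rightarrow> 'v set \<Rightarrow> enat" where
  "quotient_dim scale Z B =
     Sup {enat (card C) | C. finite C \<and> C \<subseteq> Z \<and>
            (\<forall>a. (\<Sum>v\<in>C. scale (a v) v) \<in> B \<longrightarrow> (\<forall>v\<in>C. a v = 0))}"

definition coh_dim ::
    "nat \<Rightarrow> (nat \<Rightarrow> nat) \<Rightarrow> ((nat \<Rightarrow> nat) set \<Rightarrow> 'a::field laurent set) \<Rightarrow> nat \<Rightarrow> enat" where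
  "coh_dim k n F q = quotient_dim cochain_scale (cocycles k n F q) (coboundaries k n F q)"

section \<open>Terracini loci\<close>

definition terracini_defect :: "nat \<Rightarrow> (nat \<Rightarrow> nat) \<Rightarrow> 'a::field mpoint set \<Rightarrow> enat" where
  "terracini_defect k n S = coh_dim k n (twisted_ideal k n S) 1"

definition terracini_locus1 :: "nat \<Rightarrow> (nat \<Rightarrow> nat) \<Rightarrow> nat \<Rightarrow> 'a::field mpoint set set" where
  "terracini_locus1 k n r =
     {S. S \<subseteq> multiproj k n \<and> finite S \<and> card S = r \<and>
         coh_dim k n (twisted_ideal k n S) 0 > 0 \<and> terracini_defect k n S > 0}"

definition terracini_locus :: "nat \<Rightarrow> (nat \<Rightarrow> nat) \<Rightarrow> nat \<Rightarrow> 'a::field mpoint set set" where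
  "terracini_locus k n r = {S \<in> terracini_locus1 k n r. minimal_multiproj k n S}"

end

theory Submission
  imports Defs "HOL-Computational_Algebra.Formal_Laurent_Series"
begin

text \<open>
  Minimality forces every factor to be a line and the two points \<open>p\<close>, \<open>q\<close> to differ in every factor. Then
  every factor carries a basis of linear forms, one vanishing at \<open>p\<close> and one vanishing at \<open>q\<close>, and in the
  basis of sections of \<open>O(1, \<dots>, 1)\<close> given by their products, double vanishing at \<open>p\<close> (at \<open>q\<close>) kills the
  products with at most one factor vanishing there. If \<open>k \<le> 2\<close> nothing survives, so \<open>h\<^sup>0 = 0\<close>. If
  \<open>k \<ge> 3\<close> the two groups of products are disjoint, so sections realise arbitrary first order jets at
  both points; as \<open>H\<^sup>1(O(1, \<dots>, 1)) = 0\<close> this gives \<open>h\<^sup>1 = 0\<close>.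
\<close>

section \<open>Products of modules and Laurent polynomials\<close>

text \<open>Membership in the square of a point ideal, a statement about sums of products, is
  replaced by a test along formal curves through the point: vanishing to order two as a formal
  Laurent series. Sections over \<open>U_T\<close> have negative exponents and points may have zero
  coordinates, but a curve whose coordinates are all nonzero series makes evaluation a ring
  homomorphism on all Laurent polynomials. The square of the ideal passes the test at once.
  Conversely, a first order Taylor expansion in affine coordinates shows that a section on a chart
  that passes it lies in the square. This converse is applied on single charts only, where the
  bounding cochain lives; on overlaps the given cocycle is merely tested. The step from jets to h^1
  is the argument of the long exact sequence, done on cochains: a 1-cocycle is a difference of
  sections \<open>e J\<close> of O(1, ..., 1), and since its values lie in the ideal, all
  \<open>e J\<close> have the same jet at each of the two points. Subtracting one global section
  moves every \<open>e J\<close> into the ideal and keeps the differences.\<close>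

lemma module_prodI:
  "u = (\<Sum>l<(N::nat). a l * b l) \<Longrightarrow> (\<And>l. l < N \<Longrightarrow> a l \<in> A \<and> b l \<in> B) \<Longrightarrow> u \<in> module_prod A B"
  unfolding module_prod_def by blast

lemma module_prod_zero: "0 \<in> module_prod A B"
  by (rule module_prodI[where N = 0]) auto

lemma module_prod_mult: "a \<in> A \<Longrightarrow> b \<in> B \<Longrightarrow> a * b \<in> module_prod A B"
  by (rule module_prodI[where N = 1 and a = "\<lambda>_. a" and b = "\<lambda>_. b"]) auto

lemma module_prod_snoc:
  assumes "u \<in> module_prod A B" "a \<in> A" "b \<in> B"
  shows "u + a * b \<in> module_prod A B"
proof -
  obtain N :: nat and f g where u: "u = (\<Sum>l<N. f l * g l)" "\<forall>l<N. f l \<in> A \<and> g l \<in> B"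
    using assms(1) unfolding module_prod_def by blast
  have "u + a * b = (\<Sum>l<Suc N. (f(N := a)) l * (g(N := b)) l)"
    by (simp add: u(1))
  then show ?thesis
    by (rule module_prodI) (use u(2) assms(2,3) in \<open>auto simp: less_Suc_eq\<close>)
qed

text \<open>Builds the sum one summand at a time, so that closure properties can be shown without
  index functions.\<close>

lemma module_prod_induct [consumes 1, case_names zero snoc]:
  assumes "u \<in> module_prod A B"
    and zero: "P 0"
    and snoc: "\<And>u a b. u \<in> module_prod A B \<Longrightarrow> P u \<Longrightarrow> a \<in> A \<Longrightarrow> b \<in> B \<Longrightarrow> P (u + a * b)"
  shows "P u"
proof -
  obtain N :: nat and f g where u: "u = (\<Sum>l<N. f l * g l)" "\<forall>l<N. f l \<in> A \<and> g l \<in> B"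
    using assms(1) unfolding module_prod_def by blast
  have "P (\<Sum>l<M. f l * g l) \<and> (\<Sum>l<M. f l * g l) \<in> module_prod A B" if "M \<le> N" for M
    using that
  proof (induction M)
    case 0
    then show ?case by (simp add: zero module_prod_zero)
  next
    case (Suc M)
    then show ?case using u(2) by (simp add: snoc module_prod_snoc)
  qed
  then show ?thesis using u(1) by simp
qed

lemma module_prod_add:
  assumes "u \<in> module_prod A B" "v \<in> module_prod A B"
  shows "u + v \<in> module_prod A B"
  using assms(2)
proof (induction v rule: module_prod_induct)
  case zero
  then show ?case using assms(1) by simp
next
  case (snoc v a b)
  then show ?case using module_prod_snoc[of "u + v" A B a b] by (simp add: add.assoc)
qed

lemma module_prod_mult_right:
  assumes "u \<in> module_prod A B" "\<And>b. b \<in> B \<Longrightarrow> b * r \<in> B"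
  shows "u * r \<in> module_prod A B"
  using assms(1)
proof (induction u rule: module_prod_induct)
  case zero
  then show ?case by (simp add: module_prod_zero)
next
  case (snoc u a b)
  then have "u * r + a * (b * r) \<in> module_prod A B"
    using module_prod_snoc assms(2) by blast
  then show ?case by (simp add: algebra_simps)
qed

section \<open>Laurent polynomials: constants, monomials and variables\<close>

abbreviation lconst :: "'a::field \<Rightarrow> 'a laurent" where
  "lconst a \<equiv> Poly_Mapping.single 0 a"

abbreviation lmon :: "((nat \<times> nat) \<Rightarrow>\<^sub>0 int) \<Rightarrow> 'a::field laurent" where
  "lmon m \<equiv> Poly_Mapping.single m 1"

abbreviation lvar :: "nat \<Rightarrow> nat \<Rightarrow> 'a::field laurent" where
  "lvar i j \<equiv> lmon (Poly_Mapping.single (i, j) 1)"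

lemma laurent_eq_sum: "f = (\<Sum>m\<in>Poly_Mapping.keys f. Poly_Mapping.single m (Poly_Mapping.lookup f m))"
  for f :: "'a::field laurent"
proof (rule poly_mapping_eqI)
  fix m
  show "Poly_Mapping.lookup f m =
    Poly_Mapping.lookup (\<Sum>m\<in>Poly_Mapping.keys f. Poly_Mapping.single m (Poly_Mapping.lookup f m)) m"
    by (cases "m \<in> Poly_Mapping.keys f")
      (auto simp: lookup_sum lookup_single when_def in_keys_iff sum.delta')
qed

lemma lmon_power: "lmon m ^ r = lmon (\<Sum>l<r. m)" for r :: nat
proof (induction r)
  case (Suc r)
  then show ?case by (simp add: mult_single add.commute)
qed simp

lemma lmon_prod: "finite X \<Longrightarrow> (\<Prod>i\<in>X. lmon (h i)) = lmon (\<Sum>i\<in>X. h i)"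
  by (induction X rule: finite_induct) (auto simp: mult_single)

subsection \<open>Sections of line bundles\<close>

text \<open>The sections form a space spanned by monomials, as the condition concerns each exponent
  separately; this lets the Cech complex split.\<close>

definition twist_monomial ::
    "nat \<Rightarrow> (nat \<Rightarrow> nat) \<Rightarrow> int \<Rightarrow> (nat \<Rightarrow> nat) set \<Rightarrow> ((nat \<times> nat) \<Rightarrow>\<^sub>0 int) \<Rightarrow> bool" where
  "twist_monomial k n d T m \<longleftrightarrow>
     Poly_Mapping.keys m \<subseteq> {(i, j). i < k \<and> j \<le> n i} \<and>
     (\<forall>i<k. (\<Sum>j\<le>n i. Poly_Mapping.lookup m (i, j)) = d) \<and>
     (\<forall>i j. Poly_Mapping.lookup m (i, j) < 0 \<longrightarrow> (\<exists>J\<in>T. j = J i))"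

lemma twist_sections_iff:
  "f \<in> twist_sections k n d T \<longleftrightarrow> (\<forall>m\<in>Poly_Mapping.keys f. twist_monomial k n d T m)"
  by (simp add: twist_sections_def twist_monomial_def)

lemma twist_sections_zero: "0 \<in> twist_sections k n d T"
  by (simp add: twist_sections_def)

lemma twist_sections_add:
  "f \<in> twist_sections k n d T \<Longrightarrow> g \<in> twist_sections k n d T \<Longrightarrow> f + g \<in> twist_sections k n d T"
  using keys_add[of f g] unfolding twist_sections_iff by blast

lemma twist_sections_uminus: "f \<in> twist_sections k n d T \<Longrightarrow> - f \<in> twist_sections k n d T"
  by (simp add: twist_sections_def keys_def)

lemma twist_sections_diff:
  "f \<in> twist_sections k n d T \<Longrightarrow> g \<in> twist_sections k n d T \<Longrightarrow> f - g \<in> twist_sections k n d T"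
  using twist_sections_add[of f k n d T "- g"] twist_sections_uminus[of g k n d T] by simp

lemma twist_sections_sum:
  assumes "\<And>i. i \<in> X \<Longrightarrow> f i \<in> twist_sections k n d T"
  shows "sum f X \<in> twist_sections k n d T"
  using assms by (induction X rule: infinite_finite_induct)
    (auto simp: twist_sections_zero twist_sections_add)

lemma twist_sections_mult:
  assumes "f \<in> twist_sections k n d T" "g \<in> twist_sections k n d' T"
  shows "f * g \<in> twist_sections k n (d + d') T"
  unfolding twist_sections_iff
proof
  fix m assume "m \<in> Poly_Mapping.keys (f * g)"
  then obtain a b where m: "m = a + b" and a: "a \<in> Poly_Mapping.keys f" and b: "b \<in> Poly_Mapping.keys g"
    using keys_mult[of f g] by blast
  have a': "Poly_Mapping.keys a \<subseteq> {(i, j). i < k \<and> j \<le> n i}"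
      "\<forall>i<k. (\<Sum>j\<le>n i. Poly_Mapping.lookup a (i, j)) = d"
      "\<forall>i j. Poly_Mapping.lookup a (i, j) < 0 \<longrightarrow> (\<exists>J\<in>T. j = J i)"
    using assms(1) a unfolding twist_sections_iff twist_monomial_def by blast+
  have b': "Poly_Mapping.keys b \<subseteq> {(i, j). i < k \<and> j \<le> n i}"
      "\<forall>i<k. (\<Sum>j\<le>n i. Poly_Mapping.lookup b (i, j)) = d'"
      "\<forall>i j. Poly_Mapping.lookup b (i, j) < 0 \<longrightarrow> (\<exists>J\<in>T. j = J i)"
    using assms(2) b unfolding twist_sections_iff twist_monomial_def by blast+
  have "\<exists>J\<in>T. j = J i" if "Poly_Mapping.lookup m (i, j) < 0" for i j
  proof -
    from that have "Poly_Mapping.lookup a (i, j) < 0 \<or> Poly_Mapping.lookup b (i, j) < 0"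
      by (auto simp: m lookup_add)
    then show ?thesis using a'(3) b'(3) by blast
  qed
  moreover have "Poly_Mapping.keys m \<subseteq> {(i, j). i < k \<and> j \<le> n i}"
    using a'(1) b'(1) keys_add[of a b] unfolding m by blast
  moreover have "\<forall>i<k. (\<Sum>j\<le>n i. Poly_Mapping.lookup m (i, j)) = d + d'"
    using a'(2) b'(2) by (simp add: m lookup_add sum.distrib)
  ultimately show "twist_monomial k n (d + d') T m"
    unfolding twist_monomial_def by blast
qed

lemma twist_sections_mult0:
  "f \<in> twist_sections k n 0 T \<Longrightarrow> g \<in> twist_sections k n 0 T \<Longrightarrow> f * g \<in> twist_sections k n 0 T"
  using twist_sections_mult[of f k n 0 T g 0] by simp

lemma single_in_twist_sections: "twist_monomial k n d T m \<Longrightarrow> Poly_Mapping.single m a \<in> twist_sections k n d T"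
  by (simp add: twist_sections_iff)

lemma lconst_in_twist_sections: "lconst a \<in> twist_sections k n 0 T"
  by (rule single_in_twist_sections) (simp add: twist_monomial_def)

lemma one_in_twist_sections: "1 \<in> twist_sections k n 0 T"
  using lconst_in_twist_sections[of 1 k n T] by simp

lemma twist_sections_scale: "f \<in> twist_sections k n d T \<Longrightarrow> lconst a * f \<in> twist_sections k n d T"
  using twist_sections_mult[OF lconst_in_twist_sections[of a k n T], of f d] by simp

lemma double_points_ideal_subset: "double_points_ideal k n S T \<subseteq> twist_sections k n 0 T"
  unfolding double_points_ideal_def by blast

lemma point_ideal_subset: "point_ideal k n p T \<subseteq> twist_sections k n 0 T"
  unfolding point_ideal_def by blast

lemma twisted_ideal_subset: "twisted_ideal k n S T \<subseteq> twist_sections k n 1 T"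
proof
  fix u assume "u \<in> twisted_ideal k n S T"
  then show "u \<in> twist_sections k n 1 T" unfolding twisted_ideal_def
  proof (induction u rule: module_prod_induct)
    case zero
    then show ?case by (rule twist_sections_zero)
  next
    case (snoc u a b)
    then have "a * b \<in> twist_sections k n (0 + 1) T"
      using twist_sections_mult double_points_ideal_subset by blast
    then show ?case using snoc by (simp add: twist_sections_add)
  qed
qed

section \<open>The Cech complex in degrees zero and one\<close>

text \<open>A nonempty \<open>C\<close> is refuted by the coefficients that pick out one of its
  vectors, which lies in \<open>Z\<close> and hence in \<open>B\<close>.\<close>

lemma quotient_dim_eq_0:
  fixes scale :: "'a::field \<Rightarrow> 'v::ab_group_add \<Rightarrow> 'v"
  assumes "Z \<subseteq> B" "\<And>v. scale 1 v = v" "\<And>v. scale 0 v = 0"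
  shows "quotient_dim scale Z B = 0"
proof -
  have empty: "C = {}" if C: "finite C" "C \<subseteq> Z" "\<forall>a. (\<Sum>v\<in>C. scale (a v) v) \<in> B \<longrightarrow> (\<forall>v\<in>C. a v = 0)" for C
  proof (rule ccontr)
    assume "C \<noteq> {}"
    then obtain v where v: "v \<in> C" by blast
    define a where "a = (\<lambda>w. if w = v then 1 else 0 :: 'a)"
    have "(\<Sum>w\<in>C. scale (a w) w) = (\<Sum>w\<in>C. if w = v then w else 0)"
      by (rule sum.cong) (auto simp: a_def assms)
    also have "\<dots> = v" using C(1) v by simp
    finally have "(\<Sum>w\<in>C. scale (a w) w) \<in> B" using assms(1) C(2) v by auto
    then have "a v = 0" using C(3) v by blast
    then show False by (simp add: a_def)
  qed
  have "{enat (card C) | C. finite C \<and> C \<subseteq> Z \<and>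
      (\<forall>a. (\<Sum>v\<in>C. scale (a v) v) \<in> B \<longrightarrow> (\<forall>v\<in>C. a v = 0))} \<subseteq> {0}"
  proof clarify
    fix C assume "finite C" "C \<subseteq> Z" "\<forall>a. (\<Sum>v\<in>C. scale (a v) v) \<in> B \<longrightarrow> (\<forall>v\<in>C. a v = 0)"
    then have "C = {}" by (rule empty)
    then show "enat (card C) = 0" by (simp add: zero_enat_def)
  qed
  then have "quotient_dim scale Z B \<le> Sup {0}"
    unfolding quotient_dim_def by (rule Sup_subset_mono)
  then show ?thesis by simp
qed

lemma coh_dim_eq_0: "cocycles k n F q \<subseteq> coboundaries k n F q \<Longrightarrow> coh_dim k n F q = 0"
  unfolding coh_dim_def by (rule quotient_dim_eq_0) (auto simp: cochain_scale_def fun_eq_iff)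

lemma coboundary_0_apply:
  assumes "J \<in> charts k n" "J' \<in> charts k n"
  shows "coboundary k n 0 c [J, J'] = c [J'] - c [J]"
  using assms by (simp add: coboundary_def chart_tuples_def)

lemma coboundary_1_apply:
  assumes "J \<in> charts k n" "J' \<in> charts k n" "J'' \<in> charts k n"
  shows "coboundary k n 1 c [J, J', J''] = c [J', J''] - c [J, J''] + c [J, J']"
  using assms by (simp add: coboundary_def chart_tuples_def numeral_2_eq_2)

lemma cocycle_1_apply:
  assumes "c \<in> cocycles k n F 1" "J \<in> charts k n" "J' \<in> charts k n" "J'' \<in> charts k n"
  shows "c [J', J''] = c [J, J''] - c [J, J']"
proof -
  have "coboundary k n 1 c [J, J', J''] = 0"
    using assms(1) unfolding cocycles_def by auto
  then show ?thesis using coboundary_1_apply[OF assms(2-4), of c] by (simp add: algebra_simps)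
qed

lemma coboundariesI:
  assumes c: "c \<in> cochains k n F 1"
    and e: "\<And>J. J \<in> charts k n \<Longrightarrow> e J \<in> F {J}"
    and ce: "\<And>J J'. J \<in> charts k n \<Longrightarrow> J' \<in> charts k n \<Longrightarrow> c [J, J'] = e J' - e J"
  shows "c \<in> coboundaries k n F 1"
proof -
  \<comment> \<open>Cochains live on lists and have to vanish on all lists that are not tuples of
    charts of the right length.\<close>
  define E where "E = (\<lambda>Js. if Js \<in> chart_tuples k n 0 then e (hd Js) else 0)"
  have E1: "E [J] = e J" if "J \<in> charts k n" for J
    using that by (simp add: E_def chart_tuples_def)
  have E: "E \<in> cochains k n F 0"
    unfolding cochains_def E_def by (auto simp: chart_tuples_def length_Suc_conv e)
  have "coboundary k n 0 E Js = c Js" for Js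
  proof (cases "Js \<in> chart_tuples k n 1")
    case True
    then obtain J J' where J: "Js = [J, J']" "J \<in> charts k n" "J' \<in> charts k n"
      by (auto simp: chart_tuples_def length_Suc_conv numeral_2_eq_2)
    then show ?thesis by (simp add: coboundary_0_apply ce E1)
  next
    case False
    then show ?thesis using c by (simp add: cochains_def coboundary_def)
  qed
  then have "c = coboundary k n 0 E" by (simp add: fun_eq_iff)
  then show ?thesis using E by simp
qed

lemma finite_charts: "finite (charts k n)"
  unfolding charts_def by (rule finite_PiE) auto

text \<open>
  The Cech complex of a line bundle splits by monomials. If \<open>m\<close> has multidegree \<open>d \<ge> 0\<close>, some chart \<open>J\<close> inverts no variable with a negative exponent
  in \<open>m\<close>, so adjoining \<open>J\<close> to \<open>T\<close> does not affect whether \<open>m\<close> is a section over \<open>U_T\<close>: the complex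
  of \<open>m\<close> is a cone with apex \<open>J\<close>.
\<close>

lemma cocycle_twist_sections_bounds:
  fixes c :: "'a::field cochain"
  assumes d: "d \<ge> 0"
    and sec: "\<And>J J'. J \<in> charts k n \<Longrightarrow> J' \<in> charts k n \<Longrightarrow> c [J, J'] \<in> twist_sections k n d {J, J'}"
    and coc: "\<And>J J' J''. J \<in> charts k n \<Longrightarrow> J' \<in> charts k n \<Longrightarrow> J'' \<in> charts k n \<Longrightarrow>
      c [J', J''] = c [J, J''] - c [J, J']"
  shows "\<exists>e. (\<forall>J\<in>charts k n. e J \<in> twist_sections k n d {J}) \<and>
    (\<forall>J\<in>charts k n. \<forall>J'\<in>charts k n. c [J, J'] = e J' - e J)"
proof -
  \<comment> \<open>\<open>A m\<close> is the apex chart of \<open>m\<close>. The implication makes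
    the choice possible for every \<open>m\<close>, so that \<open>A m\<close> is a chart even if
    \<open>m\<close> has another multidegree.\<close>
  define A where "A = (\<lambda>m. \<lambda>i\<in>{..<k}. SOME j. j \<le> n i \<and>
    ((\<Sum>j\<le>n i. Poly_Mapping.lookup m (i, j)) = d \<longrightarrow> Poly_Mapping.lookup m (i, j) \<ge> 0))"
  have ex: "\<exists>j. j \<le> n i \<and>
    ((\<Sum>j\<le>n i. Poly_Mapping.lookup m (i, j)) = d \<longrightarrow> Poly_Mapping.lookup m (i, j) \<ge> 0)"
    for m :: "(nat \<times> nat) \<Rightarrow>\<^sub>0 int" and i
  proof (rule ccontr)
    assume neg: "\<not> ?thesis"
    then have "\<forall>j\<le>n i. Poly_Mapping.lookup m (i, j) < 0" by (meson linorder_not_le)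
    then have "(\<Sum>j\<le>n i. Poly_Mapping.lookup m (i, j)) < (\<Sum>j\<le>n i. 0)"
      by (intro sum_strict_mono) auto
    moreover have "(\<Sum>j\<le>n i. Poly_Mapping.lookup m (i, j)) = d" using neg by blast
    ultimately show False using d by simp
  qed
  have A: "A m i \<le> n i" "(\<Sum>j\<le>n i. Poly_Mapping.lookup m (i, j)) = d \<Longrightarrow> Poly_Mapping.lookup m (i, A m i) \<ge> 0"
    if "i < k" for m i
    using someI_ex[OF ex[of i m]] that unfolding A_def by auto
  have Ac: "A m \<in> charts k n" for m
    unfolding charts_def using A(1) by (auto simp: A_def)
  \<comment> \<open>The apex depends on \<open>m\<close>, so \<open>e J\<close> collects its
    coefficients from different values of \<open>c\<close>; \<open>X J\<close> is a finite set
    containing all exponents that can occur.\<close>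
  define X where "X = (\<lambda>J. \<Union>J'\<in>charts k n. Poly_Mapping.keys (c [J', J]))"
  have fin: "finite (X J)" for J
    unfolding X_def using finite_charts by auto
  define e where "e = (\<lambda>J. \<Sum>m\<in>X J. Poly_Mapping.single m (Poly_Mapping.lookup (c [A m, J]) m))"
  have e: "Poly_Mapping.lookup (e J) m = Poly_Mapping.lookup (c [A m, J]) m" for J m
  proof -
    have "m \<notin> X J \<Longrightarrow> Poly_Mapping.lookup (c [A m, J]) m = 0"
      unfolding X_def using Ac[of m] by (auto simp: in_keys_iff)
    then show ?thesis
      unfolding e_def by (auto simp: lookup_sum lookup_single when_def sum.delta' fin)
  qed
  show ?thesis
  proof (intro exI[of _ e] conjI ballI)
    fix J assume J: "J \<in> charts k n"
    show "e J \<in> twist_sections k n d {J}"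
      unfolding twist_sections_iff
    proof
      fix m assume "m \<in> Poly_Mapping.keys (e J)"
      then have "m \<in> Poly_Mapping.keys (c [A m, J])" by (simp add: e in_keys_iff)
      with sec[OF Ac[of m] J] have
        m: "Poly_Mapping.keys m \<subseteq> {(i, j). i < k \<and> j \<le> n i}"
          "\<forall>i<k. (\<Sum>j\<le>n i. Poly_Mapping.lookup m (i, j)) = d"
          "\<forall>i j. Poly_Mapping.lookup m (i, j) < 0 \<longrightarrow> (\<exists>J'\<in>{A m, J}. j = J' i)"
        unfolding twist_sections_iff twist_monomial_def by blast+
      have "j = J i" if neg: "Poly_Mapping.lookup m (i, j) < 0" for i j
      proof (rule ccontr)
        assume "j \<noteq> J i"
        then have j: "j = A m i" using m(3) neg by blast
        have "(i, j) \<in> Poly_Mapping.keys m" using neg by (auto simp: in_keys_iff)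
        then have "i < k" using m(1) by blast
        then have "Poly_Mapping.lookup m (i, j) \<ge> 0" using A(2) m(2) j by blast
        then show False using neg by simp
      qed
      then show "twist_monomial k n d {J} m"
        using m unfolding twist_monomial_def by blast
    qed
  next
    fix J J' assume J: "J \<in> charts k n" "J' \<in> charts k n"
    show "c [J, J'] = e J' - e J"
    proof (rule poly_mapping_eqI)
      fix m
      \<comment> \<open>The coefficient of \<open>m\<close> in the cocycle relation for
        \<open>A m\<close>, \<open>J\<close>, \<open>J'\<close>: the contraction of the
        cone.\<close>
      show "Poly_Mapping.lookup (c [J, J']) m = Poly_Mapping.lookup (e J' - e J) m"
        using coc[OF Ac[of m] J] by (simp add: lookup_minus e)
    qed
  qed
qed

section \<open>Evaluation at curves\<close>

text \<open>The zero series has subdegree 0 by convention, so a lower bound on the subdegree would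
  not be closed under sums; a condition on coefficients is.\<close>

definition vanish_order :: "int \<Rightarrow> 'a::field fls \<Rightarrow> bool" where
  "vanish_order r G \<longleftrightarrow> (\<forall>n<r. fls_nth G n = 0)"

lemma vanish_order_iff: "vanish_order r G \<longleftrightarrow> G = 0 \<or> r \<le> fls_subdegree G"
  unfolding vanish_order_def using fls_subdegree_geI[of G r] by force

lemma vanish_order_0 [simp]: "vanish_order r 0"
  by (simp add: vanish_order_def)

lemma vanish_order_mono: "vanish_order r G \<Longrightarrow> s \<le> r \<Longrightarrow> vanish_order s G"
  by (simp add: vanish_order_def)

lemma vanish_order_add: "vanish_order r G \<Longrightarrow> vanish_order r H \<Longrightarrow> vanish_order r (G + H)"
  by (simp add: vanish_order_def)

lemma vanish_order_diff: "vanish_order r G \<Longrightarrow> vanish_order r H \<Longrightarrow> vanish_order r (G - H)"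
  by (simp add: vanish_order_def)

lemma vanish_order_minus_commute: "vanish_order r (G - H) \<longleftrightarrow> vanish_order r (H - G)"
  by (auto simp: vanish_order_def)

lemma vanish_order_mult:
  assumes "vanish_order r G" "vanish_order s H"
  shows "vanish_order (r + s) (G * H)"
  using assms unfolding vanish_order_iff by (cases "G = 0 \<or> H = 0") auto

lemma vanish_order_const [simp]: "vanish_order 0 (fls_const a)"
  by (simp add: vanish_order_def)

lemma vanish_order_X [simp]: "vanish_order 1 fls_X"
  by (simp add: vanish_order_iff)

lemma vanish_order_scale: "vanish_order r G \<Longrightarrow> vanish_order r (fls_const a * G)"
  using vanish_order_mult[OF vanish_order_const, of r G a] by simp

lemma vanish_order_prod:
  "finite X \<Longrightarrow> (\<And>i. i \<in> X \<Longrightarrow> vanish_order r (f i)) \<Longrightarrow> vanish_order (int (card X) * r) (prod f X)"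
  for f :: "'i \<Rightarrow> 'a::field fls"
proof (induction X rule: finite_induct)
  case empty
  then show ?case using vanish_order_const[of "1 :: 'a"] by simp
next
  case (insert x X)
  then show ?case using vanish_order_mult[of r "f x" "int (card X) * r" "prod f X"]
    by (simp add: algebra_simps)
qed

text \<open>This excludes poles as well as fixing the constant coefficient, so that values are
  compatible with products and, where nonzero, with inverses.\<close>

definition has_value :: "'a::field fls \<Rightarrow> 'a \<Rightarrow> bool" where
  "has_value G g \<longleftrightarrow> vanish_order 1 (G - fls_const g)"

lemma has_value_const [simp]: "has_value (fls_const g) g"
  by (simp add: has_value_def)

lemma has_value_1 [simp]: "has_value 1 1"
  using has_value_const[of 1] by simp

lemma has_value_0_iff: "has_value G 0 \<longleftrightarrow> vanish_order 1 G"
  by (simp add: has_value_def)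

lemma has_value_regular: "has_value G g \<Longrightarrow> vanish_order 0 G"
proof -
  assume "has_value G g"
  then have "vanish_order 0 ((G - fls_const g) + fls_const g)"
    unfolding has_value_def by (intro vanish_order_add) (auto elim: vanish_order_mono)
  then show ?thesis by simp
qed

lemma has_value_add: "has_value G g \<Longrightarrow> has_value H h \<Longrightarrow> has_value (G + H) (g + h)"
  unfolding has_value_def vanish_order_def by (simp add: add_diff_add)

lemma has_value_sum: "(\<And>i. i \<in> X \<Longrightarrow> has_value (f i) (g i)) \<Longrightarrow> has_value (sum f X) (sum g X)"
  by (induction X rule: infinite_finite_induct)
    (auto simp: has_value_add has_value_0_iff)

lemma has_value_mult:
  assumes "has_value G g" "has_value H h"
  shows "has_value (G * H) (g * h)"
proof -
  have "vanish_order (1 + 0) ((G - fls_const g) * H)"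
    using assms has_value_regular by (intro vanish_order_mult) (auto simp: has_value_def)
  moreover have "vanish_order 1 (fls_const g * (H - fls_const h))"
    using assms by (intro vanish_order_scale) (auto simp: has_value_def)
  ultimately have "vanish_order 1 ((G - fls_const g) * H + fls_const g * (H - fls_const h))"
    using vanish_order_add by simp
  moreover have "(G - fls_const g) * H + fls_const g * (H - fls_const h) = G * H - fls_const (g * h)"
    by (simp add: algebra_simps flip: fls_const_mult_const)
  ultimately show ?thesis by (simp add: has_value_def)
qed

lemma has_value_prod: "(\<And>i. i \<in> X \<Longrightarrow> has_value (f i) (g i)) \<Longrightarrow> has_value (prod f X) (prod g X)"
  by (induction X rule: infinite_finite_induct) (auto simp: has_value_mult)

lemma has_value_nonzero:
  assumes "has_value G g" "g \<noteq> 0"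
  shows "G \<noteq> 0" "fls_subdegree G = 0"
proof -
  have "fls_nth (G - fls_const g) n = 0" if "n \<le> 0" for n
    using assms(1) that unfolding has_value_def vanish_order_def by simp
  then have "fls_nth G n = (if n = 0 then g else 0)" if "n \<le> 0" for n
    using that by (cases "n = 0") fastforce+
  then have "fls_nth G 0 = g" "\<And>n. n < 0 \<Longrightarrow> fls_nth G n = 0" by auto
  with assms(2) show "G \<noteq> 0" "fls_subdegree G = 0" using fls_subdegree_eqI[of G 0] by auto
qed

lemma has_value_inverse:
  assumes "has_value G g" "g \<noteq> 0"
  shows "has_value (inverse G) (inverse g)"
proof -
  note G = has_value_nonzero[OF assms]
  have "vanish_order 0 (inverse G)"
    using G by (simp add: vanish_order_iff fls_inverse_subdegree)
  then have "vanish_order (0 + (1 + 0)) (fls_const (inverse g) * ((fls_const g - G) * inverse G))"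
    using assms(1) by (intro vanish_order_mult) (auto simp: has_value_def vanish_order_minus_commute)
  moreover have "fls_const (inverse g) * ((fls_const g - G) * inverse G) = inverse G - fls_const (inverse g)"
  proof -
    have "fls_const (inverse g) * fls_const g = 1"
      using assms(2) by (simp add: fls_const_mult_const)
    moreover have "fls_const (inverse g) * ((fls_const g - G) * inverse G)
        = (fls_const (inverse g) * fls_const g) * inverse G - fls_const (inverse g) * (G * inverse G)"
      by (simp add: algebra_simps)
    ultimately show ?thesis using G by simp
  qed
  ultimately show ?thesis by (simp add: has_value_def)
qed

lemma has_value_power: "has_value G g \<Longrightarrow> has_value (G ^ m) (g ^ m)"
  by (induction m) (auto simp: has_value_mult)

lemma has_value_power_int:
  assumes "has_value G g" "z \<ge> 0 \<or> g \<noteq> 0"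
  shows "has_value (G powi z) (g powi z)"
  using assms by (auto simp: power_int_def has_value_power has_value_inverse)

text \<open>The target is any field, to serve both for scalar points and for curves with coordinates
  in Laurent series.\<close>

definition mon_eval :: "(nat \<times> nat \<Rightarrow> 'b::field) \<Rightarrow> ((nat \<times> nat) \<Rightarrow>\<^sub>0 int) \<Rightarrow> 'b" where
  "mon_eval x m = (\<Prod>v\<in>Poly_Mapping.keys m. x v powi Poly_Mapping.lookup m v)"

definition fls_eval :: "(nat \<times> nat \<Rightarrow> 'a::field fls) \<Rightarrow> 'a laurent \<Rightarrow> 'a fls" where
  "fls_eval x f =
     (\<Sum>m\<in>Poly_Mapping.keys f. fls_const (Poly_Mapping.lookup f m) * mon_eval x m)"

lemma laurent_eval_altdef:
  "laurent_eval f x = (\<Sum>m\<in>Poly_Mapping.keys f. Poly_Mapping.lookup f m * mon_eval (\<lambda>(i, j). x i j) m)"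
  unfolding laurent_eval_def mon_eval_def by (simp add: case_prod_unfold)

lemma mon_eval_superset:
  "finite X \<Longrightarrow> Poly_Mapping.keys m \<subseteq> X \<Longrightarrow> mon_eval x m = (\<Prod>v\<in>X. x v powi Poly_Mapping.lookup m v)"
  unfolding mon_eval_def by (rule prod.mono_neutral_left) (auto simp: in_keys_iff)

lemma mon_eval_0 [simp]: "mon_eval x 0 = 1"
  by (simp add: mon_eval_def)

lemma mon_eval_single [simp]: "mon_eval x (Poly_Mapping.single v z) = x v powi z"
  by (simp add: mon_eval_def)

text \<open>At a zero coordinate the rule breaks: exponents 1 and -1 cancel in the sum and give 1,
  whereas the product of the two values is 0.\<close>

lemma mon_eval_add:
  assumes "\<And>v. v \<in> Poly_Mapping.keys m \<union> Poly_Mapping.keys m' \<Longrightarrow> x v \<noteq> 0"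
  shows "mon_eval x (m + m') = mon_eval x m * mon_eval x m'"
proof -
  let ?X = "Poly_Mapping.keys m \<union> Poly_Mapping.keys m'"
  have "mon_eval x (m + m') = (\<Prod>v\<in>?X. x v powi Poly_Mapping.lookup (m + m') v)"
    by (rule mon_eval_superset) (use keys_add[of m m'] in auto)
  also have "\<dots> = (\<Prod>v\<in>?X. x v powi Poly_Mapping.lookup m v * x v powi Poly_Mapping.lookup m' v)"
    by (rule prod.cong) (use assms in \<open>auto simp: lookup_add power_int_add\<close>)
  also have "\<dots> = mon_eval x m * mon_eval x m'"
    by (simp add: prod.distrib mon_eval_superset[of ?X])
  finally show ?thesis .
qed

lemma laurent_eval_superset:
  "finite X \<Longrightarrow> Poly_Mapping.keys f \<subseteq> X \<Longrightarrow>
    laurent_eval f x = (\<Sum>m\<in>X. Poly_Mapping.lookup f m * mon_eval (\<lambda>(i, j). x i j) m)"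
  unfolding laurent_eval_altdef by (rule sum.mono_neutral_left) (auto simp: in_keys_iff)

lemma laurent_eval_single:
  "laurent_eval (Poly_Mapping.single m a) x = a * mon_eval (\<lambda>(i, j). x i j) m"
  by (simp add: laurent_eval_altdef)

lemma laurent_eval_add: "laurent_eval (f + g) x = laurent_eval f x + laurent_eval g x"
proof -
  let ?X = "Poly_Mapping.keys f \<union> Poly_Mapping.keys g"
  have "laurent_eval (f + g) x = (\<Sum>m\<in>?X. Poly_Mapping.lookup (f + g) m * mon_eval (\<lambda>(i, j). x i j) m)"
    by (rule laurent_eval_superset) (use keys_add[of f g] in auto)
  also have "\<dots> = laurent_eval f x + laurent_eval g x"
    by (simp add: lookup_add distrib_right sum.distrib laurent_eval_superset[of ?X])
  finally show ?thesis .
qed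

lemma fls_eval_superset:
  "finite X \<Longrightarrow> Poly_Mapping.keys f \<subseteq> X \<Longrightarrow>
    fls_eval x f = (\<Sum>m\<in>X. fls_const (Poly_Mapping.lookup f m) * mon_eval x m)"
  unfolding fls_eval_def by (rule sum.mono_neutral_left) (auto simp: in_keys_iff)

lemma fls_eval_single: "fls_eval x (Poly_Mapping.single m a) = fls_const a * mon_eval x m"
  by (simp add: fls_eval_def)

lemma fls_eval_0 [simp]: "fls_eval x 0 = 0"
  by (simp add: fls_eval_def)

lemma fls_eval_1 [simp]: "fls_eval x 1 = 1"
  using fls_eval_single[of x 0 1] by simp

lemma fls_eval_add: "fls_eval x (f + g) = fls_eval x f + fls_eval x g"
proof -
  let ?X = "Poly_Mapping.keys f \<union> Poly_Mapping.keys g"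
  have "fls_eval x (f + g) = (\<Sum>m\<in>?X. fls_const (Poly_Mapping.lookup (f + g) m) * mon_eval x m)"
    by (rule fls_eval_superset) (use keys_add[of f g] in auto)
  also have "\<dots> = fls_eval x f + fls_eval x g"
    by (simp only: lookup_add fls_plus_const[symmetric] distrib_right sum.distrib) (simp add: fls_eval_superset[of ?X])
  finally show ?thesis .
qed

lemma fls_eval_sum: "fls_eval x (sum f X) = (\<Sum>i\<in>X. fls_eval x (f i))"
proof (induction X rule: infinite_finite_induct)
  case (insert i X)
  then show ?case by (simp add: fls_eval_add)
qed simp_all

lemma fls_eval_uminus: "fls_eval x (- f) = - fls_eval x f"
proof -
  have "fls_eval x f + fls_eval x (- f) = 0"
    by (simp flip: fls_eval_add)
  then show ?thesis by (simp add: minus_unique)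
qed

lemma fls_eval_diff: "fls_eval x (f - g) = fls_eval x f - fls_eval x g"
  using fls_eval_add[of x f "- g"] by (simp add: fls_eval_uminus)

lemma fls_eval_mult:
  assumes "\<And>v. x v \<noteq> 0"
  shows "fls_eval x (f * g) = fls_eval x f * fls_eval x g"
proof -
  have "f * g = (\<Sum>m\<in>Poly_Mapping.keys f. Poly_Mapping.single m (Poly_Mapping.lookup f m)) *
      (\<Sum>m'\<in>Poly_Mapping.keys g. Poly_Mapping.single m' (Poly_Mapping.lookup g m'))"
    by (simp flip: laurent_eq_sum)
  also have "fls_eval x \<dots> = fls_eval x f * fls_eval x g"
    by (simp add: sum_product fls_eval_sum mult_single fls_eval_single fls_eval_def[of x f]
        fls_eval_def[of x g] mon_eval_add[OF assms] algebra_simps flip: fls_const_mult_const)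
  finally show ?thesis .
qed

lemma fls_eval_prod:
  assumes "\<And>v. x v \<noteq> 0"
  shows "fls_eval x (prod f X) = (\<Prod>i\<in>X. fls_eval x (f i))"
  by (induction X rule: infinite_finite_induct) (auto simp: fls_eval_mult assms)

lemma fls_eval_lconst: "fls_eval x (lconst a) = fls_const a"
  by (simp add: fls_eval_single)

lemma fls_eval_lvar: "fls_eval x (lvar i j) = x (i, j)"
  by (simp add: fls_eval_single)

text \<open>A section over \<open>U_T\<close> has negative exponents only at variables
  \<open>x (i, J i)\<close> with \<open>J\<close> in \<open>T\<close>, and there the value is
  nonzero. So every monomial is regular and its value can be taken factor by factor.\<close>

lemma fls_eval_has_value:
  assumes f: "f \<in> twist_sections k n d T"
    and x: "\<And>i j. i < k \<Longrightarrow> j \<le> n i \<Longrightarrow> has_value (x (i, j)) (x0 i j)"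
    and nz: "\<And>J i. J \<in> T \<Longrightarrow> i < k \<Longrightarrow> x0 i (J i) \<noteq> 0"
  shows "has_value (fls_eval x f) (laurent_eval f x0)"
  unfolding fls_eval_def laurent_eval_altdef mon_eval_def
proof (intro has_value_sum has_value_mult has_value_const has_value_prod has_value_power_int)
  fix m v assume m: "m \<in> Poly_Mapping.keys f" and v: "v \<in> Poly_Mapping.keys m"
  obtain i j where ij: "v = (i, j)" by fastforce
  have m': "twist_monomial k n d T m" using f m by (simp add: twist_sections_iff)
  then have "i < k" "j \<le> n i" using v ij unfolding twist_monomial_def by auto
  then show "has_value (x v) ((\<lambda>(i, j). x0 i j) v)" using x ij by simp
  show "0 \<le> Poly_Mapping.lookup m v \<or> (\<lambda>(i, j). x0 i j) v \<noteq> 0"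
  proof (cases "0 \<le> Poly_Mapping.lookup m v")
    case False
    then obtain J where "J \<in> T" "j = J i" using m' ij unfolding twist_monomial_def by force
    then show ?thesis using nz \<open>i < k\<close> ij by auto
  qed simp
qed

section \<open>Jets at a point of a product of lines\<close>

text \<open>
  The curve \<open>\<epsilon> \<mapsto> x + c \<epsilon> y\<close>. When \<open>x i\<close> and \<open>y i\<close> are independent and \<open>c i \<noteq> 0\<close> for all \<open>i\<close>, none of
  its coordinates is the zero series, so every Laurent polynomial can be evaluated along it.
\<close>

definition curve :: "nat \<Rightarrow> (nat \<Rightarrow> nat \<Rightarrow> 'a::field) \<Rightarrow> (nat \<Rightarrow> nat \<Rightarrow> 'a) \<Rightarrow> (nat \<Rightarrow> 'a) \<Rightarrow> nat \<times> nat \<Rightarrow> 'a fls" where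
  "curve k x y c = (\<lambda>(i, j). if i < k \<and> j \<le> 1 then fls_const (x i j) + fls_const (c i * y i j) * fls_X else 1)"

text \<open>The linear form in the \<open>i\<close>-th variables that vanishes at \<open>x i\<close> and takes the value \<open>1\<close> at \<open>y i\<close>\<close>

definition lform :: "(nat \<Rightarrow> nat \<Rightarrow> 'a::field) \<Rightarrow> (nat \<Rightarrow> nat \<Rightarrow> 'a) \<Rightarrow> nat \<Rightarrow> 'a laurent" where
  "lform x y i =
     lconst (x i 0 / (x i 0 * y i 1 - x i 1 * y i 0)) * lvar i 1 +
     lconst (- x i 1 / (x i 0 * y i 1 - x i 1 * y i 0)) * lvar i 0"

text \<open>The exponent of the generator of O(1, ..., 1) over \<open>U_J\<close>; multiplication by
  the inverse of this generator dehomogenises.\<close>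

definition chart_monomial :: "nat \<Rightarrow> (nat \<Rightarrow> nat) \<Rightarrow> (nat \<times> nat) \<Rightarrow>\<^sub>0 int" where
  "chart_monomial k J = (\<Sum>i<k. Poly_Mapping.single (i, J i) 1)"

lemma lookup_chart_monomial:
  "Poly_Mapping.lookup (chart_monomial k J) (i, j) = (if i < k \<and> j = J i then 1 else 0)"
proof -
  have "Poly_Mapping.lookup (chart_monomial k J) (i, j) = (\<Sum>i'<k. if i' = i then (if j = J i then 1 else 0) else 0)"
    unfolding chart_monomial_def lookup_sum by (rule sum.cong) (auto simp: lookup_single when_def)
  then show ?thesis by simp
qed

lemma twist_chart_monomial:
  assumes "\<And>i. i < k \<Longrightarrow> J i \<le> n i"
  shows "twist_monomial k n 1 T (chart_monomial k J)"
    and "twist_monomial k n (- 1) {J} (- chart_monomial k J)"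
  using assms unfolding twist_monomial_def
  by (auto simp: lookup_chart_monomial in_keys_iff sum_negf split: if_splits)

lemma chart_monomial_inverse: "lmon (chart_monomial k J) * lmon (- chart_monomial k J) = 1"
  by (simp add: mult_single)

lemma lmon_chart_monomial: "lmon (chart_monomial k J) = (\<Prod>i<k. lvar i (J i))"
  by (simp add: lmon_prod chart_monomial_def)

text \<open>Expanding the product picks one of the two variables of each factor, and
  \<open>J\<close> records the choice.\<close>

lemma keys_prod_linear:
  "Poly_Mapping.keys (\<Prod>i<m. lconst (a i) * lvar i 1 + lconst (b i) * lvar i 0)
     \<subseteq> {chart_monomial m J | J. \<forall>i. J i \<le> 1}"
proof (induction m)
  case 0
  then show ?case by (auto simp: chart_monomial_def intro!: exI[of _ "\<lambda>_. 0"])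
next
  case (Suc m)
  let ?l = "lconst (a m) * lvar m 1 + lconst (b m) * lvar m 0"
  have l: "Poly_Mapping.keys ?l \<subseteq> {Poly_Mapping.single (m, j) 1 | j. j \<le> 1}"
    using keys_add[of "lconst (a m) * lvar m 1" "lconst (b m) * lvar m 0"]
    by (auto simp: mult_single split: if_splits)
  show ?case
  proof
    fix u assume "u \<in> Poly_Mapping.keys (\<Prod>i<Suc m. lconst (a i) * lvar i 1 + lconst (b i) * lvar i 0)"
    then obtain v w where u: "u = v + w" "v \<in> Poly_Mapping.keys (\<Prod>i<m. lconst (a i) * lvar i 1 + lconst (b i) * lvar i 0)"
      "w \<in> Poly_Mapping.keys ?l"
      using keys_mult[of "\<Prod>i<m. lconst (a i) * lvar i 1 + lconst (b i) * lvar i 0" ?l] by auto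
    obtain J where J: "v = chart_monomial m J" "\<forall>i. J i \<le> 1" using u(2) Suc by blast
    obtain j where j: "w = Poly_Mapping.single (m, j) 1" "j \<le> 1" using u(3) l by blast
    have "u = chart_monomial (Suc m) (J(m := j))"
      by (simp add: u(1) J(1) j(1) chart_monomial_def)
    moreover have "\<forall>i. (J(m := j)) i \<le> 1" using J j by simp
    ultimately show "u \<in> {chart_monomial (Suc m) J | J. \<forall>i. J i \<le> 1}" by blast
  qed
qed

lemma prod_linear_in_twist_sections:
  assumes n: "\<And>i. i < k \<Longrightarrow> n i = 1"
    and f: "\<And>i. i < k \<Longrightarrow> f i = lconst (a i) * lvar i 1 + lconst (b i) * lvar i 0"
  shows "(\<Prod>i<k. f i) \<in> twist_sections k n 1 T"
proof -
  have "(\<Prod>i<k. f i) = (\<Prod>i<k. lconst (a i) * lvar i 1 + lconst (b i) * lvar i 0)"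
    by (rule prod.cong) (use f in auto)
  moreover have "twist_monomial k n 1 T m" if m: "m \<in> Poly_Mapping.keys (\<Prod>i<k. lconst (a i) * lvar i 1 + lconst (b i) * lvar i 0)" for m
  proof -
    obtain J where "m = chart_monomial k J" "\<forall>i. J i \<le> 1"
      using m keys_prod_linear[where m = k and a = a and b = b] by blast
    then show ?thesis using n by (simp add: twist_chart_monomial(1))
  qed
  ultimately show ?thesis by (simp add: twist_sections_iff)
qed

text \<open>\<open>x\<close> and \<open>y\<close> are coordinate vectors of \<open>p\<close> and
  \<open>q\<close>, and \<open>y i\<close> also serves as the tangent direction at
  \<open>x i\<close>. The assumptions are symmetric up to the sign of the determinant, so
  \<open>swap\<close> turns each result at \<open>p\<close> into one at \<open>q\<close>.\<close>

locale two_points =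
  fixes k :: nat and n :: "nat \<Rightarrow> nat" and p q :: "'a::field_char_0 mpoint" and x y :: "nat \<Rightarrow> nat \<Rightarrow> 'a"
  assumes n: "i < k \<Longrightarrow> n i = 1"
    and p_rep: "i < k \<Longrightarrow> x i \<in> p i" "i < k \<Longrightarrow> v \<in> p i \<Longrightarrow> \<exists>c. c \<noteq> 0 \<and> v = vec_scale c (x i)"
    and q_rep: "i < k \<Longrightarrow> y i \<in> q i" "i < k \<Longrightarrow> v \<in> q i \<Longrightarrow> \<exists>c. c \<noteq> 0 \<and> v = vec_scale c (y i)"
    and det: "i < k \<Longrightarrow> x i 0 * y i 1 - x i 1 * y i 0 \<noteq> 0"
begin

lemma swap: "two_points k n q p y x"
proof
  fix i assume "i < k"
  then have "y i 0 * x i 1 - y i 1 * x i 0 = - (x i 0 * y i 1 - x i 1 * y i 0)"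
      "x i 0 * y i 1 - x i 1 * y i 0 \<noteq> 0"
    using det[of i] by (auto simp: algebra_simps)
  then show "y i 0 * x i 1 - y i 1 * x i 0 \<noteq> 0" by (metis neg_equal_0_iff_equal)
qed (use n p_rep q_rep in auto)

abbreviation ev :: "(nat \<Rightarrow> 'a) \<Rightarrow> 'a laurent \<Rightarrow> 'a fls" where
  "ev c \<equiv> fls_eval (curve k x y c)"

definition admissible :: "(nat \<Rightarrow> 'a) \<Rightarrow> bool" where
  "admissible c \<longleftrightarrow> (\<forall>i<k. c i \<noteq> 0)"

text \<open>By independence \<open>x i j\<close> and \<open>y i j\<close> do not vanish together, so
  the constant or the linear coefficient survives, \<open>c i\<close> being nonzero. At all other
  indices \<open>curve\<close> has the default value 1, because \<open>fls_eval_mult\<close> asks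
  for nonzero values everywhere.\<close>

lemma curve_nonzero:
  assumes "admissible c"
  shows "curve k x y c v \<noteq> 0"
proof -
  obtain i j where v: "v = (i, j)" by fastforce
  show ?thesis
  proof (cases "i < k \<and> j \<le> 1")
    case True
    then have "x i j \<noteq> 0 \<or> y i j \<noteq> 0" using det[of i] by (cases "j = 0") (auto simp: le_Suc_eq)
    then have "fls_nth (curve k x y c v) 0 \<noteq> 0 \<or> fls_nth (curve k x y c v) 1 \<noteq> 0"
      using True assms by (auto simp: v curve_def admissible_def)
    then show ?thesis by auto
  qed (auto simp: v curve_def)
qed

lemmas ev_mult = fls_eval_mult[OF curve_nonzero]
lemmas ev_prod = fls_eval_prod[OF curve_nonzero]

lemma curve_has_value: "i < k \<Longrightarrow> j \<le> n i \<Longrightarrow> has_value (curve k x y c (i, j)) (x i j)"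
  using vanish_order_scale[OF vanish_order_X, of "c i * y i j"] n[of i]
  by (simp add: curve_def has_value_def)

lemma ev_linear:
  assumes c: "admissible c" and i: "i < k"
  shows "ev c (lconst a * lvar i 1 + lconst b * lvar i 0) =
    fls_const (a * x i 1 + b * x i 0) + fls_const (a * (c i * y i 1) + b * (c i * y i 0)) * fls_X"
proof -
  have "curve k x y c (i, 0) = fls_const (x i 0) + fls_const (c i * y i 0) * fls_X"
    "curve k x y c (i, 1) = fls_const (x i 1) + fls_const (c i * y i 1) * fls_X"
    using i by (auto simp: curve_def)
  then show ?thesis
    unfolding fls_eval_add ev_mult[OF c] fls_eval_lconst fls_eval_lvar
    by (simp add: algebra_simps flip: fls_plus_const fls_const_mult_const)
qed

text \<open>The curve moves in the direction \<open>y i\<close>: a form that vanishes at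
  \<open>y i\<close> is constant along it, and one that vanishes at \<open>x i\<close> is a multiple
  of the parameter.\<close>

lemma ev_lform:
  assumes c: "admissible c" and i: "i < k"
  shows "ev c (lform x y i) = fls_const (c i) * fls_X" "ev c (lform y x i) = 1"
proof -
  define d where "d = x i 0 * y i 1 - x i 1 * y i 0"
  have d: "d \<noteq> 0" "y i 0 * x i 1 - y i 1 * x i 0 = - d"
    using det[OF i] by (auto simp: d_def algebra_simps)
  have "x i 0 / d * x i 1 + (- x i 1 / d) * x i 0 = 0" by simp
  moreover have "x i 0 / d * (c i * y i 1) + (- x i 1 / d) * (c i * y i 0) = c i"
  proof -
    have "x i 0 / d * (c i * y i 1) + (- x i 1 / d) * (c i * y i 0) =
        (x i 0 * (c i * y i 1) - x i 1 * (c i * y i 0)) / d"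
      by (simp add: diff_divide_distrib)
    also have "x i 0 * (c i * y i 1) - x i 1 * (c i * y i 0) = c i * d"
      by (simp add: d_def algebra_simps)
    finally show ?thesis using d(1) by simp
  qed
  ultimately show "ev c (lform x y i) = fls_const (c i) * fls_X"
    unfolding lform_def d_def[symmetric] by (simp only: ev_linear[OF c i]) simp
  have "y i 0 / - d * x i 1 + (- y i 1 / - d) * x i 0 = 1"
  proof -
    have "y i 0 / - d * x i 1 + (- y i 1 / - d) * x i 0 = (y i 1 * x i 0 - y i 0 * x i 1) / d"
      by (simp add: diff_divide_distrib)
    also have "y i 1 * x i 0 - y i 0 * x i 1 = d"
      by (simp add: d_def algebra_simps)
    finally show ?thesis using d(1) by simp
  qed
  moreover have "y i 0 / - d * (c i * y i 1) + (- y i 1 / - d) * (c i * y i 0) = 0" by simp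
  ultimately show "ev c (lform y x i) = 1"
    unfolding lform_def d by (simp only: ev_linear[OF c i]) simp
qed

lemma in_open_iff: "in_open k T p \<longleftrightarrow> (\<forall>J\<in>T. \<forall>i<k. x i (J i) \<noteq> 0)"
  unfolding in_open_def using p_rep by (fastforce simp: vec_scale_def)

text \<open>Unit vectors are not admissible, but each is the difference of two admissible weights:
  all ones with a 2 in place \<open>i\<close>, and all ones. Characteristic 0 keeps 2 from
  vanishing.\<close>

lemma linear_form_eq_0:
  assumes "\<And>c. admissible c \<Longrightarrow> (\<Sum>i<k. c i * b i) = 0" and i: "i < k"
  shows "b i = (0::'a)"
proof -
  have "(\<Sum>i'<k. (if i' = i then 2 else 1) * b i') = (0::'a)"
    by (rule assms) (auto simp: admissible_def)
  moreover have "(\<Sum>i'<k. 1 * b i') = (0::'a)"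
    by (rule assms) (auto simp: admissible_def)
  moreover have "(\<Sum>i'<k. (if i' = i then 2 else 1) * b i') = (\<Sum>i'<k. 1 * b i' + (if i' = i then b i' else 0))"
    by (rule sum.cong) auto
  moreover have "(\<Sum>i'<k. 1 * b i' + (if i' = i then b i' else 0)) = (\<Sum>i'<k. 1 * b i') + b i"
    using i by (simp add: sum.distrib)
  ultimately show ?thesis by simp
qed

text \<open>The curve test for double vanishing at \<open>p\<close>. No chart occurs in it, so
  sections over different charts can be compared; \<open>double_zero_ideal_square\<close> and
  \<open>double_zero_imp_ideal_square\<close> link it to the square of the ideal.\<close>

definition double_zero :: "'a laurent \<Rightarrow> bool" where
  "double_zero f \<longleftrightarrow> (\<forall>c. admissible c \<longrightarrow> vanish_order 2 (ev c f))"

lemma double_zero_diff: "double_zero f \<Longrightarrow> double_zero g \<Longrightarrow> double_zero (f - g)"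
  by (auto simp: double_zero_def fls_eval_diff intro: vanish_order_diff)

lemma double_zero_add: "double_zero f \<Longrightarrow> double_zero g \<Longrightarrow> double_zero (f + g)"
  by (auto simp: double_zero_def fls_eval_add intro: vanish_order_add)

lemma ev_regular:
  assumes "f \<in> twist_sections k n d T" "in_open k T p"
  shows "has_value (ev c f) (laurent_eval f x)"
  using assms by (intro fls_eval_has_value curve_has_value) (auto simp: in_open_iff)

lemma ev_point_ideal:
  assumes "f \<in> point_ideal k n p T" "in_open k T p"
  shows "vanish_order 1 (ev c f)"
proof -
  have "laurent_eval f x = 0"
    using assms p_rep(1) unfolding point_ideal_def vanishes_at_def by blast
  then show ?thesis
    using assms ev_regular[of f 0 T c] unfolding point_ideal_def by (simp add: has_value_0_iff)
qed

text \<open>Both factors of each summand vanish to order one along the curve. The point has to lie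
  in \<open>U_T\<close>, as otherwise \<open>point_ideal\<close> is the unit ideal.\<close>

lemma double_zero_ideal_square:
  assumes "f \<in> module_prod (point_ideal k n p T) (point_ideal k n p T)" "in_open k T p"
  shows "double_zero f"
  using assms(1)
proof (induction f rule: module_prod_induct)
  case zero
  then show ?case by (simp add: double_zero_def)
next
  case (snoc u a b)
  have "vanish_order 2 (ev c (a * b))" if "admissible c" for c
    using vanish_order_mult[of 1 "ev c a" 1 "ev c b"] ev_point_ideal snoc assms(2)
    by (simp add: ev_mult[OF that])
  then have "double_zero (a * b)" by (simp add: double_zero_def)
  then show ?case using snoc by (simp add: double_zero_add)
qed

lemma double_zero_twisted_ideal:
  assumes "f \<in> twisted_ideal k n S T" "p \<in> S" "in_open k T p"
  shows "double_zero f"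
  using assms(1) unfolding twisted_ideal_def
proof (induction f rule: module_prod_induct)
  case zero
  then show ?case by (simp add: double_zero_def)
next
  case (snoc u a b)
  have "double_zero a"
    using snoc assms by (intro double_zero_ideal_square) (auto simp: double_points_ideal_def)
  then have "vanish_order 2 (ev c (a * b))" if "admissible c" for c
    using vanish_order_mult[of 2 "ev c a" 0 "ev c b"] has_value_regular[OF ev_regular[OF _ assms(3)]] snoc that
    by (simp add: ev_mult[OF that] double_zero_def)
  then have "double_zero (a * b)" by (simp add: double_zero_def)
  then show ?case using snoc by (simp add: double_zero_add)
qed

text \<open>The first order Taylor polynomial at \<open>p\<close>: \<open>a\<close> is the value and
  \<open>b i\<close> the derivative in the \<open>i\<close>-th factor in the direction
  \<open>y i\<close>. One \<open>b\<close> has to serve for all weights \<open>c\<close>.\<close>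

definition has_jet :: "'a laurent \<Rightarrow> 'a \<Rightarrow> (nat \<Rightarrow> 'a) \<Rightarrow> bool" where
  "has_jet f a b \<longleftrightarrow>
     (\<forall>c. admissible c \<longrightarrow> vanish_order 2 (ev c f - (fls_const a + fls_const (\<Sum>i<k. c i * b i) * fls_X)))"

lemma has_jet_0_iff: "has_jet f 0 (\<lambda>_. 0) \<longleftrightarrow> double_zero f"
  by (simp add: has_jet_def double_zero_def)

lemma has_jet_lconst: "has_jet (lconst a) a (\<lambda>_. 0)"
  by (simp add: has_jet_def fls_eval_lconst)

lemma has_jet_lvar: "i < k \<Longrightarrow> j \<le> 1 \<Longrightarrow> has_jet (lvar i j) (x i j) (\<lambda>i'. if i' = i then y i j else 0)"
proof -
  assume ij: "i < k" "j \<le> 1"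
  have "(\<Sum>i'<k. c i' * (if i' = i then y i j else 0)) = c i * y i j" for c
    using ij(1) by (simp add: if_distrib cong: if_cong)
  then show ?thesis using ij by (simp add: has_jet_def fls_eval_lvar curve_def)
qed

lemma has_jet_add:
  assumes "has_jet f a b" "has_jet g a' b'"
  shows "has_jet (f + g) (a + a') (\<lambda>i. b i + b' i)"
  unfolding has_jet_def
proof (intro allI impI)
  fix c assume c: "admissible c"
  let ?\<beta> = "\<Sum>i<k. c i * b i" and ?\<beta>' = "\<Sum>i<k. c i * b' i"
  have "vanish_order 2 ((ev c f - (fls_const a + fls_const ?\<beta> * fls_X)) + (ev c g - (fls_const a' + fls_const ?\<beta>' * fls_X)))"
    using assms c unfolding has_jet_def by (blast intro: vanish_order_add)
  moreover have "(\<Sum>i<k. c i * (b i + b' i)) = ?\<beta> + ?\<beta>'"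
    by (simp add: distrib_left sum.distrib)
  ultimately show "vanish_order 2 (ev c (f + g) - (fls_const (a + a') + fls_const (\<Sum>i<k. c i * (b i + b' i)) * fls_X))"
    by (simp add: fls_eval_add algebra_simps flip: fls_plus_const)
qed

lemma has_jet_mult:
  assumes "has_jet f a b" "has_jet g a' b'"
  shows "has_jet (f * g) (a * a') (\<lambda>i. a * b' i + a' * b i)"
  unfolding has_jet_def
proof (intro allI impI)
  fix c assume c: "admissible c"
  define \<beta> where "\<beta> = (\<Sum>i<k. c i * b i)"
  define \<beta>' where "\<beta>' = (\<Sum>i<k. c i * b' i)"
  define F where "F = ev c f - (fls_const a + fls_const \<beta> * fls_X)"
  define G where "G = ev c g - (fls_const a' + fls_const \<beta>' * fls_X)"
  have F: "vanish_order 2 F" and G: "vanish_order 2 G"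
    using assms c unfolding has_jet_def F_def G_def \<beta>_def \<beta>'_def by auto
  have reg: "vanish_order 0 (fls_const u + fls_const v * fls_X)" for u v :: 'a
    by (intro vanish_order_add vanish_order_scale vanish_order_const vanish_order_mono[OF vanish_order_X]) simp
  have "vanish_order 0 (ev c g)"
    using vanish_order_add[OF vanish_order_mono[OF G, of 0] reg[of a' \<beta>']] by (simp add: G_def)
  then have 1: "vanish_order 2 (F * ev c g)" using vanish_order_mult[OF F] by fastforce
  have 2: "vanish_order 2 (G * (fls_const a + fls_const \<beta> * fls_X))" using vanish_order_mult[OF G reg] by simp
  have 3: "vanish_order 2 (fls_const (\<beta> * \<beta>') * (fls_X * fls_X))"
    using vanish_order_mult[OF vanish_order_X vanish_order_X, where 'a = 'a] by (intro vanish_order_scale) simp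
  have s: "(\<Sum>i<k. c i * (a * b' i + a' * b i)) = a * \<beta>' + a' * \<beta>"
    by (simp add: \<beta>_def \<beta>'_def sum_distrib_left sum.distrib algebra_simps)
  \<comment> \<open>The error consists of the error of \<open>f\<close> times \<open>g\<close>, the
    error of \<open>g\<close> times the jet of \<open>f\<close>, and the product of the two linear
    terms.\<close>
  have "ev c (f * g) - (fls_const (a * a') + fls_const (a * \<beta>' + a' * \<beta>) * fls_X)
      = F * ev c g + G * (fls_const a + fls_const \<beta> * fls_X) + fls_const (\<beta> * \<beta>') * (fls_X * fls_X)"
    by (simp add: ev_mult[OF c] F_def G_def algebra_simps flip: fls_plus_const fls_const_mult_const)
  with 1 2 3 show "vanish_order 2 (ev c (f * g) - (fls_const (a * a') + fls_const (\<Sum>i<k. c i * (a * b' i + a' * b i)) * fls_X))"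
    unfolding s by (simp add: vanish_order_add)
qed

lemma has_jet_prod: "finite X \<Longrightarrow> (\<And>i. i \<in> X \<Longrightarrow> \<exists>a b. has_jet (f i) a b) \<Longrightarrow> \<exists>a b. has_jet (prod f X) a b"
proof (induction X rule: finite_induct)
  case empty
  then show ?case using has_jet_lconst[of 1] by auto
next
  case (insert i X)
  then obtain a b a' b' where "has_jet (f i) a b" "has_jet (prod f X) a' b'" by blast
  from has_jet_mult[OF this] insert show ?case by auto
qed

lemma has_jet_sum:
  "(\<And>i. i \<in> X \<Longrightarrow> has_jet (f i) (a i) (b i)) \<Longrightarrow> has_jet (sum f X) (sum a X) (\<lambda>j. \<Sum>i\<in>X. b i j)"
proof (induction X rule: infinite_finite_induct)
  case (insert i X)
  then have "has_jet (f i) (a i) (b i)" "has_jet (sum f X) (sum a X) (\<lambda>j. \<Sum>i\<in>X. b i j)" by auto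
  from has_jet_add[OF this] insert(1,2) show ?case by simp
qed (use has_jet_lconst[of 0] in auto)

text \<open>The coefficients of degree 0 and 1 along each curve vanish; the second is a linear form
  in the weights, and \<open>linear_form_eq_0\<close> separates its coefficients.\<close>

lemma jet_double_zero:
  assumes "has_jet f a b" "double_zero f"
  shows "a = 0" "i < k \<Longrightarrow> b i = 0"
proof -
  have *: "vanish_order 2 (fls_const a + fls_const (\<Sum>i<k. c i * b i) * fls_X)" if "admissible c" for c
    using vanish_order_diff[of 2 "ev c f" "ev c f - (fls_const a + fls_const (\<Sum>i<k. c i * b i) * fls_X)"]
      assms that by (simp add: has_jet_def double_zero_def)
  have "admissible (\<lambda>_. 1)" by (simp add: admissible_def)
  from *[OF this] show "a = 0" unfolding vanish_order_def by (auto dest!: spec[of _ 0])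
  have "(\<Sum>i<k. c i * b i) = 0" if "admissible c" for c
    using *[OF that] unfolding vanish_order_def by (auto dest!: spec[of _ 1])
  then show "i < k \<Longrightarrow> b i = 0" by (rule linear_form_eq_0)
qed

end

subsection \<open>The ideal of a point\<close>

lemma has_value_unique: "has_value G g \<Longrightarrow> has_value G h \<Longrightarrow> g = h"
  unfolding has_value_def vanish_order_def by (auto dest!: spec[of _ 0])

lemma laurent_eval_mult:
  assumes f: "f \<in> twist_sections k n d T" and g: "g \<in> twist_sections k n d' T"
    and nz: "\<And>J i. J \<in> T \<Longrightarrow> i < k \<Longrightarrow> x i (J i) \<noteq> 0"
  shows "laurent_eval (f * g) x = laurent_eval f x * laurent_eval g x"
proof -
  \<comment> \<open>All coordinates of the point \<open>x + \<epsilon>\<close> are invertible, so evaluation there is multiplicative.\<close>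
  define X where "X = (\<lambda>(i, j). fls_const (x i j) + fls_X)"
  have X: "has_value (X (i, j)) (x i j)" for i j
    by (simp add: X_def has_value_def)
  have "X v \<noteq> 0" for v
  proof -
    have "fls_nth (X v) 1 \<noteq> 0" by (simp add: X_def case_prod_unfold)
    then show ?thesis by auto
  qed
  then have "fls_eval X (f * g) = fls_eval X f * fls_eval X g"
    by (rule fls_eval_mult)
  moreover have "has_value (fls_eval X (f * g)) (laurent_eval (f * g) x)"
    by (rule fls_eval_has_value[OF twist_sections_mult[OF f g]]) (use X nz in auto)
  moreover have "has_value (fls_eval X f * fls_eval X g) (laurent_eval f x * laurent_eval g x)"
    by (intro has_value_mult fls_eval_has_value[OF f] fls_eval_has_value[OF g]) (use X nz in auto)
  ultimately show ?thesis by (metis has_value_unique)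
qed

lemma point_ideal_add:
  "f \<in> point_ideal k n p T \<Longrightarrow> g \<in> point_ideal k n p T \<Longrightarrow> f + g \<in> point_ideal k n p T"
  unfolding point_ideal_def vanishes_at_def by (auto simp: twist_sections_add laurent_eval_add)

lemma point_ideal_mult:
  assumes "f \<in> point_ideal k n p T" "g \<in> twist_sections k n 0 T"
  shows "f * g \<in> point_ideal k n p T"
proof -
  have f: "f \<in> twist_sections k n 0 T" using assms(1) by (simp add: point_ideal_def)
  have "laurent_eval (f * g) z = 0" if "in_open k T p" "\<forall>i<k. z i \<in> p i" for z
  proof -
    have "laurent_eval (f * g) z = laurent_eval f z * laurent_eval g z"
      by (rule laurent_eval_mult[OF f assms(2)]) (use that in \<open>auto simp: in_open_def\<close>)
    moreover have "laurent_eval f z = 0"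
      using assms(1) that unfolding point_ideal_def vanishes_at_def by blast
    ultimately show ?thesis by simp
  qed
  then show ?thesis
    using twist_sections_mult0[OF f assms(2)] unfolding point_ideal_def vanishes_at_def by blast
qed

lemma point_ideal_scale: "f \<in> point_ideal k n p T \<Longrightarrow> lconst a * f \<in> point_ideal k n p T"
  using point_ideal_mult[of f k n p T "lconst a"] lconst_in_twist_sections[of a k n T]
  by (simp add: mult.commute)

lemma zero_in_point_ideal: "0 \<in> point_ideal k n p T"
  unfolding point_ideal_def vanishes_at_def by (auto simp: twist_sections_zero laurent_eval_altdef)

lemma point_ideal_sum:
  "(\<And>i. i \<in> X \<Longrightarrow> f i \<in> point_ideal k n p T) \<Longrightarrow> sum f X \<in> point_ideal k n p T"
  by (induction X rule: infinite_finite_induct) (auto simp: zero_in_point_ideal point_ideal_add)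

abbreviation ideal_square :: "nat \<Rightarrow> (nat \<Rightarrow> nat) \<Rightarrow> 'a::field mpoint \<Rightarrow> (nat \<Rightarrow> nat) set \<Rightarrow> 'a laurent set" where
  "ideal_square k n p T \<equiv> module_prod (point_ideal k n p T) (point_ideal k n p T)"

lemma ideal_square_mult:
  "f \<in> ideal_square k n p T \<Longrightarrow> g \<in> twist_sections k n 0 T \<Longrightarrow> f * g \<in> ideal_square k n p T"
  by (rule module_prod_mult_right) (auto intro: point_ideal_mult)

lemma ideal_square_subset: "ideal_square k n p T \<subseteq> twist_sections k n 0 T"
proof
  fix u assume "u \<in> ideal_square k n p T"
  then show "u \<in> twist_sections k n 0 T"
  proof (induction u rule: module_prod_induct)
    case (snoc u a b)
    then show ?case using point_ideal_subset by (blast intro: twist_sections_add twist_sections_mult0)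
  qed (rule twist_sections_zero)
qed

text \<open>Away from the point the ideal is the unit ideal, so \<open>f * 1\<close> is a product of
  two of its elements.\<close>

lemma ideal_square_not_in_open:
  fixes f :: "'a::field laurent"
  assumes "f \<in> twist_sections k n 0 T" "\<not> in_open k T p"
  shows "f \<in> ideal_square k n p T"
  using module_prod_mult[of f "point_ideal k n p T" 1 "point_ideal k n p T"] assms
    one_in_twist_sections[of k n T, where 'a = 'a]
  by (simp add: point_ideal_def)

subsection \<open>Affine coordinates\<close>

text \<open>The exponent of the affine coordinate \<open>x (i, 1 - J i) / x (i, J i)\<close> of the
  \<open>i\<close>-th line; \<open>1 - J i\<close> is the other index, since \<open>J i\<close> is 0
  or 1.\<close>

definition coord_monomial :: "(nat \<Rightarrow> nat) \<Rightarrow> nat \<Rightarrow> (nat \<times> nat) \<Rightarrow>\<^sub>0 int" where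
  "coord_monomial J i = Poly_Mapping.single (i, 1 - J i) 1 - Poly_Mapping.single (i, J i) 1"

definition centred_coord :: "(nat \<Rightarrow> nat \<Rightarrow> 'a::field) \<Rightarrow> (nat \<Rightarrow> nat) \<Rightarrow> nat \<Rightarrow> 'a laurent" where
  "centred_coord x J i = lmon (coord_monomial J i) + lconst (- x i (1 - J i) / x i (J i))"

lemma lookup_coord_monomial:
  "J i \<le> 1 \<Longrightarrow> Poly_Mapping.lookup (coord_monomial J i) (i', j) =
    (if i' = i then (if j = J i then - 1 else if j = 1 - J i then 1 else 0) else 0)"
proof -
  assume "J i \<le> 1"
  then have "J i \<noteq> 1 - J i" by presburger
  then show ?thesis by (auto simp: coord_monomial_def lookup_minus lookup_single when_def)
qed

lemma atMost_1: "{..1::nat} = {0, 1}"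
  by auto

lemma twist_coord_monomial:
  assumes "i < k" "J i \<le> 1" "n i = 1"
  shows "twist_monomial k n 0 {J} (coord_monomial J i)"
proof -
  have "i' < k \<and> j \<le> n i'" if "(i', j) \<in> Poly_Mapping.keys (coord_monomial J i)" for i' j
    using that assms by (auto simp: in_keys_iff lookup_coord_monomial split: if_splits)
  moreover have "(\<Sum>j\<le>n i'. Poly_Mapping.lookup (coord_monomial J i) (i', j)) = 0" for i'
  proof (cases "i' = i")
    case True
    then show ?thesis
      using assms(2,3) by (auto simp: lookup_coord_monomial[of J i, OF assms(2)] atMost_1 le_Suc_eq simp del: One_nat_def)
  qed (simp add: lookup_coord_monomial[of J i, OF assms(2)])
  moreover have "j = J i'" if "Poly_Mapping.lookup (coord_monomial J i) (i', j) < 0" for i' j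
    using that by (auto simp: lookup_coord_monomial[of J i, OF assms(2)] split: if_splits)
  ultimately show ?thesis unfolding twist_monomial_def by blast
qed

lemma mon_eval_coord_monomial:
  assumes "J i \<le> 1"
  shows "mon_eval x (coord_monomial J i) = x (i, 1 - J i) / x (i, J i)"
proof -
  have "mon_eval x (coord_monomial J i) =
      (\<Prod>v\<in>{(i, J i), (i, 1 - J i)}. x v powi Poly_Mapping.lookup (coord_monomial J i) v)"
    by (rule mon_eval_superset)
      (use assms in \<open>auto simp: in_keys_iff lookup_coord_monomial split: if_splits\<close>)
  moreover have "J i \<noteq> 1 - J i" using assms by presburger
  ultimately show ?thesis
    using assms by (simp add: lookup_coord_monomial power_int_minus field_simps)
qed

text \<open>Only \<open>x (i, J i)\<close> may be inverted, and the two exponents in each factor add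
  up to 0. So the exponent of the other variable is nonnegative and determines both: functions on
  \<open>U_J\<close> are polynomials in the affine coordinates.\<close>

lemma lmon_eq_prod_coords:
  assumes n: "\<And>i. i < k \<Longrightarrow> n i = 1" and J: "\<And>i. i < k \<Longrightarrow> J i \<le> 1"
    and m: "twist_monomial k n 0 {J} m"
  shows "lmon m = (\<Prod>i<k. lmon (coord_monomial J i) ^ nat (Poly_Mapping.lookup m (i, 1 - J i)))"
proof -
  have nn: "Poly_Mapping.lookup m (i, 1 - J i) \<ge> 0" if "i < k" for i
  proof (rule ccontr)
    assume "\<not> ?thesis"
    then have "1 - J i = J i" using m unfolding twist_monomial_def by force
    then show False using J[OF that] by presburger
  qed
  have sum0: "Poly_Mapping.lookup m (i, J i) = - Poly_Mapping.lookup m (i, 1 - J i)" if "i < k" for i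
  proof -
    have "(\<Sum>j\<le>n i. Poly_Mapping.lookup m (i, j)) = 0" using m that unfolding twist_monomial_def by blast
    then have "Poly_Mapping.lookup m (i, 0) + Poly_Mapping.lookup m (i, 1) = 0"
      using n[OF that] by (simp add: atMost_1 del: One_nat_def)
    moreover have "J i = 0 \<or> J i = 1" using J[OF that] by auto
    ultimately show ?thesis by auto
  qed
  have "m = (\<Sum>i<k. \<Sum>l<nat (Poly_Mapping.lookup m (i, 1 - J i)). coord_monomial J i)"
  proof (rule poly_mapping_eqI)
    fix v :: "nat \<times> nat"
    obtain a b where v: "v = (a, b)" by fastforce
    have "Poly_Mapping.lookup (\<Sum>i<k. \<Sum>l<nat (Poly_Mapping.lookup m (i, 1 - J i)). coord_monomial J i) v =
        (\<Sum>i<k. int (nat (Poly_Mapping.lookup m (i, 1 - J i))) * Poly_Mapping.lookup (coord_monomial J i) v)"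
      by (simp add: lookup_sum)
    also have "\<dots> = (\<Sum>i<k. if i = a then Poly_Mapping.lookup m (a, 1 - J a) *
        (if b = J a then - 1 else if b = 1 - J a then 1 else 0) else 0)"
      by (rule sum.cong) (use J nn in \<open>auto simp: v lookup_coord_monomial\<close>)
    also have "\<dots> = (if a < k then Poly_Mapping.lookup m (a, 1 - J a) *
        (if b = J a then - 1 else if b = 1 - J a then 1 else 0) else 0)"
      by simp
    also have "\<dots> = Poly_Mapping.lookup m v"
    proof (cases "a < k \<and> b \<le> 1")
      case True
      then have "b = J a \<or> b = 1 - J a" using J[of a] by presburger
      then show ?thesis using True sum0 by (auto simp: v)
    next
      case False
      then have "v \<notin> Poly_Mapping.keys m" using m n unfolding twist_monomial_def v by auto
      then show ?thesis using False J[of a] by (auto simp: v in_keys_iff)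
    qed
    finally show "Poly_Mapping.lookup m v = Poly_Mapping.lookup (\<Sum>i<k. \<Sum>l<nat (Poly_Mapping.lookup m (i, 1 - J i)). coord_monomial J i) v"
      by simp
  qed
  then show ?thesis by (simp add: lmon_power lmon_prod)
qed

section \<open>First order Taylor expansion on a chart and its comparison with jets\<close>

context two_points
begin

text \<open>First order Taylor expansion at \<open>p\<close>: congruence modulo the square of the
  point ideal to a polynomial of degree at most one in the centred coordinates.\<close>

definition affine :: "(nat \<Rightarrow> nat) \<Rightarrow> 'a laurent \<Rightarrow> bool" where
  "affine J g \<longleftrightarrow> (\<exists>a b h. h \<in> ideal_square k n p {J} \<and>
     g = lconst a + (\<Sum>i<k. lconst (b i) * centred_coord x J i) + h)"

lemma affineI:
  "h \<in> ideal_square k n p {J} \<Longrightarrow>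
    g = lconst a + (\<Sum>i<k. lconst (b i) * centred_coord x J i) + h \<Longrightarrow> affine J g"
  unfolding affine_def by blast

lemma exists_chart: "\<exists>J\<in>charts k n. in_open k {J} p"
proof
  \<comment> \<open>The determinant excludes \<open>x i 0 = x i 1 = 0\<close>, so one of the two
    coordinates can be inverted at \<open>p\<close>.\<close>
  let ?J = "\<lambda>i\<in>{..<k}. if x i 0 \<noteq> 0 then 0 else 1"
  show "?J \<in> charts k n" using n by (auto simp: charts_def)
  show "in_open k {?J} p" using det by (force simp: in_open_iff)
qed

context
  fixes J
  assumes J: "J \<in> charts k n" and nz: "in_open k {J} p"
begin

lemma J_le: "i < k \<Longrightarrow> J i \<le> 1"
  using J n[of i] PiE_mem[of J "{..<k}" "\<lambda>i. {..n i}" i] by (simp add: charts_def)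

lemma x_J: "i < k \<Longrightarrow> x i (J i) \<noteq> 0"
  using nz by (simp add: in_open_iff)

lemma centred_coord_in_point_ideal:
  assumes i: "i < k"
  shows "centred_coord x J i \<in> point_ideal k n p {J}"
proof -
  have "laurent_eval (centred_coord x J i) z = 0" if z: "\<forall>i<k. z i \<in> p i" for z
  proof -
    obtain c where c: "c \<noteq> 0" "z i = vec_scale c (x i)" using p_rep(2) z i by blast
    then have "z i (1 - J i) / z i (J i) = x i (1 - J i) / x i (J i)"
      using x_J[OF i] by (simp add: vec_scale_def)
    then show ?thesis
      by (simp add: centred_coord_def laurent_eval_add laurent_eval_single mon_eval_coord_monomial[of J i, OF J_le[OF i]])
  qed
  moreover have "centred_coord x J i \<in> twist_sections k n 0 {J}"
    unfolding centred_coord_def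
    by (intro twist_sections_add lconst_in_twist_sections single_in_twist_sections twist_coord_monomial)
      (use i J_le n in auto)
  ultimately show ?thesis by (simp add: point_ideal_def vanishes_at_def)
qed

lemma linear_part_in_point_ideal: "(\<Sum>i<k. lconst (b i) * centred_coord x J i) \<in> point_ideal k n p {J}"
  by (intro point_ideal_sum point_ideal_scale centred_coord_in_point_ideal) simp

lemma affine_lconst: "affine J (lconst a)"
  by (rule affineI[where b = "\<lambda>_. 0", OF module_prod_zero]) simp

lemma affine_1: "affine J 1"
  using affine_lconst[of 1] by simp

lemma affine_centred_coord: "i < k \<Longrightarrow> affine J (centred_coord x J i)"
proof -
  assume i: "i < k"
  have "(\<Sum>i'<k. lconst (if i' = i then 1 else 0) * centred_coord x J i') =
      (\<Sum>i'<k. if i' = i then centred_coord x J i' else 0)"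
    by (rule sum.cong) auto
  also have "\<dots> = centred_coord x J i" using i by simp
  finally show ?thesis
    by (intro affineI[where a = 0 and b = "\<lambda>i'. if i' = i then 1 else 0", OF module_prod_zero]) simp
qed

lemma affine_add:
  assumes "affine J f" "affine J g"
  shows "affine J (f + g)"
proof -
  obtain a b h a' b' h' where
    f: "f = lconst a + (\<Sum>i<k. lconst (b i) * centred_coord x J i) + h" "h \<in> ideal_square k n p {J}" and
    g: "g = lconst a' + (\<Sum>i<k. lconst (b' i) * centred_coord x J i) + h'" "h' \<in> ideal_square k n p {J}"
    using assms unfolding affine_def by blast
  have "f + g = lconst (a + a') + (\<Sum>i<k. lconst (b i + b' i) * centred_coord x J i) + (h + h')"
    by (simp add: f(1) g(1) single_add distrib_right sum.distrib algebra_simps)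
  then show ?thesis by (rule affineI[OF module_prod_add[OF f(2) g(2)]])
qed

lemma affine_mult:
  assumes "affine J f" "affine J g"
  shows "affine J (f * g)"
proof -
  let ?w = "centred_coord x J"
  obtain a b h a' b' h' where
    f: "f = lconst a + (\<Sum>i<k. lconst (b i) * ?w i) + h" "h \<in> ideal_square k n p {J}" and
    g: "g = lconst a' + (\<Sum>i<k. lconst (b' i) * ?w i) + h'" "h' \<in> ideal_square k n p {J}"
    using assms unfolding affine_def by blast
  define L where "L = (\<Sum>i<k. lconst (b i) * ?w i)"
  define L' where "L' = (\<Sum>i<k. lconst (b' i) * ?w i)"
  \<comment> \<open>The second order part: \<open>L * L'\<close> is a product of two elements of the
    ideal, and the other terms are multiples of \<open>h\<close> and \<open>h'\<close>.\<close>
  define H where "H = L * L' + h * g + h' * (lconst a + L)"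
  have f': "f = lconst a + L + h" and g': "g = lconst a' + L' + h'"
    unfolding L_def L'_def by (fact f(1), fact g(1))
  have L: "L \<in> point_ideal k n p {J}" "L' \<in> point_ideal k n p {J}"
    unfolding L_def L'_def by (rule linear_part_in_point_ideal)+
  then have L0: "L \<in> twist_sections k n 0 {J}" "L' \<in> twist_sections k n 0 {J}"
    using point_ideal_subset by blast+
  have "g \<in> twist_sections k n 0 {J}"
    unfolding g' using L0 g(2) ideal_square_subset
    by (blast intro: twist_sections_add lconst_in_twist_sections)
  then have H: "H \<in> ideal_square k n p {J}"
    unfolding H_def using L L0 f(2) g(2)
    by (intro module_prod_add module_prod_mult ideal_square_mult twist_sections_add lconst_in_twist_sections)
  have "(\<Sum>i<k. lconst (a * b' i + a' * b i) * ?w i) = lconst a * L' + lconst a' * L"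
    unfolding L_def L'_def sum_distrib_left sum.distrib[symmetric]
    by (rule sum.cong) (auto simp: single_add distrib_right mult_single mult.assoc[symmetric])
  moreover have "lconst (a * a') = lconst a * lconst a'" by (simp add: mult_single)
  moreover have "f * g = lconst a * lconst a' + (lconst a * L' + lconst a' * L) + H"
    unfolding H_def by (simp add: f' g' algebra_simps)
  ultimately have "f * g = lconst (a * a') + (\<Sum>i<k. lconst (a * b' i + a' * b i) * ?w i) + H"
    by simp
  then show ?thesis by (rule affineI[OF H])
qed

lemma affine_power: "affine J f \<Longrightarrow> affine J (f ^ r)"
  by (induction r) (auto simp: affine_mult affine_1)

lemma affine_prod: "(\<And>i. i \<in> X \<Longrightarrow> affine J (f i)) \<Longrightarrow> affine J (prod f X)"
  by (induction X rule: infinite_finite_induct) (auto simp: affine_mult affine_1)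

lemma affine_sum: "(\<And>i. i \<in> X \<Longrightarrow> affine J (f i)) \<Longrightarrow> affine J (sum f X)"
  using affine_lconst[of 0] by (induction X rule: infinite_finite_induct) (auto simp: affine_add)

text \<open>The functions with such an expansion form a ring that contains the constants and the
  affine coordinates, and these generate all functions on \<open>U_J\<close>.\<close>

lemma affine_regular:
  assumes "g \<in> twist_sections k n 0 {J}"
  shows "affine J g"
proof -
  have coord: "affine J (lmon (coord_monomial J i))" if "i < k" for i
    using affine_add[OF affine_centred_coord[OF that] affine_lconst[of "x i (1 - J i) / x i (J i)"]]
    by (simp add: centred_coord_def add.assoc flip: single_add)
  have "affine J (Poly_Mapping.single m (Poly_Mapping.lookup g m))" if "m \<in> Poly_Mapping.keys g" for m
  proof -
    have "lmon m = (\<Prod>i<k. lmon (coord_monomial J i) ^ nat (Poly_Mapping.lookup m (i, 1 - J i)) :: 'a laurent)"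
      by (rule lmon_eq_prod_coords[where n = n]) (use n J_le assms that in \<open>auto simp: twist_sections_iff\<close>)
    moreover have "affine J (\<Prod>i<k. lmon (coord_monomial J i) ^ nat (Poly_Mapping.lookup m (i, 1 - J i)))"
      by (intro affine_prod affine_power coord) simp
    ultimately have "affine J (lmon m)" by simp
    then have "affine J (lconst (Poly_Mapping.lookup g m) * lmon m)"
      by (intro affine_mult affine_lconst)
    then show ?thesis by (simp add: mult_single)
  qed
  then have "affine J (\<Sum>m\<in>Poly_Mapping.keys g. Poly_Mapping.single m (Poly_Mapping.lookup g m))"
    by (rule affine_sum)
  then show ?thesis by (simp flip: laurent_eq_sum)
qed

lemma has_jet_centred_coord:
  assumes i: "i < k"
  obtains \<gamma> where "\<gamma> \<noteq> 0" "has_jet (centred_coord x J i) 0 (\<lambda>i'. if i' = i then \<gamma> else 0)"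
proof -
  define r where "r = x i (1 - J i) / x i (J i)"
  \<comment> \<open>Up to sign, this is the determinant divided by \<open>x i (J i)\<close>.\<close>
  define \<delta> where "\<delta> = y i (1 - J i) - r * y i (J i)"
  have xr: "x i (1 - J i) = r * x i (J i)" using x_J[OF i] by (simp add: r_def)
  have "J i = 0 \<or> J i = 1" using J_le[OF i] by auto
  then have \<delta>: "\<delta> \<noteq> 0"
    using det[OF i] xr by (auto simp: \<delta>_def)
  have "has_jet (centred_coord x J i) 0 (\<lambda>i'. if i' = i then \<delta> / x i (J i) else 0)"
    unfolding has_jet_def
  proof (intro allI impI)
    fix c assume c: "admissible c"
    define C where "C = curve k x y c (i, J i)"
    have C0: "C \<noteq> 0" unfolding C_def by (rule curve_nonzero[OF c])
    have C: "C = fls_const (x i (J i)) + fls_const (c i * y i (J i)) * fls_X"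
      using i J_le[OF i] by (simp add: C_def curve_def)
    have C': "curve k x y c (i, 1 - J i) = fls_const (r * x i (J i)) + fls_const (c i * (\<delta> + r * y i (J i))) * fls_X"
      using i by (simp add: curve_def xr[symmetric] \<delta>_def)
    \<comment> \<open>Dividing by \<open>C\<close> and subtracting \<open>r\<close>, the value of
      the affine coordinate at \<open>p\<close>, leaves \<open>c i * \<delta>\<close> times the
      parameter over \<open>C\<close>. To first order \<open>C\<close> may be replaced by its value
      \<open>x i (J i)\<close>.\<close>
    have "curve k x y c (i, 1 - J i) = fls_const r * C + fls_const (c i * \<delta>) * fls_X"
      unfolding C' C by (simp add: algebra_simps flip: fls_plus_const fls_const_mult_const)
    then have "ev c (centred_coord x J i) = fls_const (c i * \<delta>) * fls_X * inverse C"
      using C0 by (simp add: centred_coord_def fls_eval_add fls_eval_single mon_eval_coord_monomial[of J i, OF J_le[OF i]]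
          r_def[symmetric] C_def[symmetric] add_divide_distrib divide_inverse[of _ C] distrib_right fls_const_uminus del: One_nat_def)
    then have "ev c (centred_coord x J i) - fls_const (c i * (\<delta> / x i (J i))) * fls_X =
        fls_const (c i * \<delta>) * (fls_X * (inverse C - fls_const (inverse (x i (J i)))))"
      by (simp add: divide_inverse algebra_simps flip: fls_const_mult_const)
    moreover have "has_value (inverse C) (inverse (x i (J i)))"
      unfolding C_def using i J_le n x_J by (intro has_value_inverse curve_has_value) auto
    then have "vanish_order (1 + 1) (fls_X * (inverse C - fls_const (inverse (x i (J i)))))"
      by (intro vanish_order_mult vanish_order_X) (simp add: has_value_def)
    then have "vanish_order 2 (fls_const (c i * \<delta>) * (fls_X * (inverse C - fls_const (inverse (x i (J i))))))"
      by (intro vanish_order_scale) simp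
    moreover have "(\<Sum>i'<k. c i' * (if i' = i then \<delta> / x i (J i) else 0)) = c i * (\<delta> / x i (J i))"
      using i by (simp add: if_distrib cong: if_cong)
    ultimately show "vanish_order 2 (ev c (centred_coord x J i) -
        (fls_const 0 + fls_const (\<Sum>i'<k. c i' * (if i' = i then \<delta> / x i (J i) else 0)) * fls_X))"
      by simp
  qed
  then show thesis using that[of "\<delta> / x i (J i)"] \<delta> x_J[OF i] by simp
qed

text \<open>The curve test is diagonal in the centred coordinates, with nonzero factors \<gamma>
  common to all expansions, so it detects each Taylor coefficient.\<close>

lemma has_jet_affine:
  "\<exists>\<gamma>. (\<forall>i<k. \<gamma> i \<noteq> 0) \<and>
    (\<forall>a b h. h \<in> ideal_square k n p {J} \<longrightarrow>
      has_jet (lconst a + (\<Sum>i<k. lconst (b i) * centred_coord x J i) + h) a (\<lambda>j. if j < k then b j * \<gamma> j else 0))"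
proof -
  have "\<forall>i. \<exists>\<gamma>. i < k \<longrightarrow> \<gamma> \<noteq> 0 \<and> has_jet (centred_coord x J i) 0 (\<lambda>i'. if i' = i then \<gamma> else 0)"
    using has_jet_centred_coord by metis
  then obtain \<gamma> where \<gamma>: "\<And>i. i < k \<Longrightarrow> \<gamma> i \<noteq> 0"
    "\<And>i. i < k \<Longrightarrow> has_jet (centred_coord x J i) 0 (\<lambda>i'. if i' = i then \<gamma> i else 0)"
    by metis
  show ?thesis
  proof (intro exI[of _ \<gamma>] conjI allI impI)
    fix a b h assume h: "h \<in> ideal_square k n p {J}"
    have "has_jet (lconst (b i) * centred_coord x J i) 0 (\<lambda>i'. if i' = i then b i * \<gamma> i else 0)" if "i < k" for i
    proof -
      have "has_jet (lconst (b i) * centred_coord x J i) (b i * 0)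
          (\<lambda>i'. b i * (if i' = i then \<gamma> i else 0) + 0 * 0)"
        by (rule has_jet_mult[OF has_jet_lconst \<gamma>(2)[OF that]])
      moreover have "(\<lambda>i'. b i * (if i' = i then \<gamma> i else 0) + 0 * 0) = (\<lambda>i'. if i' = i then b i * \<gamma> i else 0)"
        by auto
      ultimately show ?thesis by (simp only: mult_zero_right)
    qed
    then have "has_jet (\<Sum>i<k. lconst (b i) * centred_coord x J i) (\<Sum>i<k. 0) (\<lambda>i'. \<Sum>i<k. if i' = i then b i * \<gamma> i else 0)"
      by (intro has_jet_sum) simp
    from has_jet_add[OF has_jet_add[OF has_jet_lconst[of a] this] has_jet_0_iff[THEN iffD2, OF double_zero_ideal_square[OF h nz]]]
    show "has_jet (lconst a + (\<Sum>i<k. lconst (b i) * centred_coord x J i) + h) a (\<lambda>j. if j < k then b j * \<gamma> j else 0)"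
      by (simp add: sum.delta')
  qed (use \<gamma> in auto)
qed

lemma dehomogenize:
  fixes e :: "'a laurent"
  assumes "e \<in> twist_sections k n 1 {J}"
  shows "e * lmon (- chart_monomial k J) \<in> twist_sections k n 0 {J}"
    and "e = (e * lmon (- chart_monomial k J)) * lmon (chart_monomial k J)"
proof -
  have "lmon (- chart_monomial k J) \<in> (twist_sections k n (- 1) {J} :: 'a laurent set)"
    by (intro single_in_twist_sections twist_chart_monomial) (use J_le n in auto)
  from twist_sections_mult[OF assms this] show "e * lmon (- chart_monomial k J) \<in> twist_sections k n 0 {J}"
    by simp
  show "e = (e * lmon (- chart_monomial k J)) * lmon (chart_monomial k J)"
    using chart_monomial_inverse[of k J, where 'a = 'a] by (simp add: mult.assoc mult.commute[of "lmon (- chart_monomial k J)"])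
qed

text \<open>Dehomogenising multiplies by a series without pole, so the double zero persists.
  Comparing jets then removes the constant and linear terms of the Taylor expansion, and the
  remainder lies in the square.\<close>

lemma double_zero_imp_ideal_square:
  fixes e :: "'a laurent"
  assumes e: "e \<in> twist_sections k n 1 {J}" and dz: "double_zero e"
  shows "e * lmon (- chart_monomial k J) \<in> ideal_square k n p {J}"
proof -
  let ?g = "e * lmon (- chart_monomial k J)"
  obtain \<gamma> where \<gamma>: "\<forall>i<k. \<gamma> i \<noteq> 0"
    "\<forall>a b h. h \<in> ideal_square k n p {J} \<longrightarrow>
      has_jet (lconst a + (\<Sum>i<k. lconst (b i) * centred_coord x J i) + h) a (\<lambda>j. if j < k then b j * \<gamma> j else 0)"
    using has_jet_affine by (elim exE conjE)
  obtain a b h where g: "?g = lconst a + (\<Sum>i<k. lconst (b i) * centred_coord x J i) + h"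
    "h \<in> ideal_square k n p {J}"
    using affine_regular[OF dehomogenize(1)[OF e]] unfolding affine_def by blast
  have inv: "lmon (- chart_monomial k J) \<in> (twist_sections k n (- 1) {J} :: 'a laurent set)"
    by (intro single_in_twist_sections twist_chart_monomial) (use J_le n in auto)
  have "vanish_order (2 + 0) (ev c ?g)" if "admissible c" for c
    unfolding ev_mult[OF that]
    using dz that has_value_regular[OF ev_regular[OF inv nz]] by (intro vanish_order_mult) (auto simp: double_zero_def)
  then have "double_zero ?g" by (simp add: double_zero_def)
  moreover have "has_jet ?g a (\<lambda>j. if j < k then b j * \<gamma> j else 0)"
    unfolding g(1) by (rule \<gamma>(2)[rule_format, OF g(2)])
  ultimately have "a = 0" "\<And>i. i < k \<Longrightarrow> b i * \<gamma> i = 0"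
    using jet_double_zero by (blast, fastforce)
  then have "?g = h" using g(1) \<gamma>(1) by simp
  then show ?thesis using g(2) by simp
qed

text \<open>The dehomogenised section has a jet by its Taylor expansion, the chart monomial has one
  as a product of variables, and jets multiply.\<close>

lemma has_jet_section:
  fixes e :: "'a laurent"
  assumes e: "e \<in> twist_sections k n 1 {J}"
  shows "\<exists>a b. has_jet e a b"
proof -
  let ?g = "e * lmon (- chart_monomial k J)"
  obtain \<gamma> where \<gamma>: "\<forall>i<k. \<gamma> i \<noteq> 0"
    "\<forall>a b h. h \<in> ideal_square k n p {J} \<longrightarrow>
      has_jet (lconst a + (\<Sum>i<k. lconst (b i) * centred_coord x J i) + h) a (\<lambda>j. if j < k then b j * \<gamma> j else 0)"
    using has_jet_affine by (elim exE conjE)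
  obtain a b h where g: "?g = lconst a + (\<Sum>i<k. lconst (b i) * centred_coord x J i) + h"
    "h \<in> ideal_square k n p {J}"
    using affine_regular[OF dehomogenize(1)[OF e]] unfolding affine_def by blast
  have 1: "has_jet ?g a (\<lambda>j. if j < k then b j * \<gamma> j else 0)"
    unfolding g(1) by (rule \<gamma>(2)[rule_format, OF g(2)])
  have "\<exists>a b. has_jet (\<Prod>i<k. lvar i (J i)) a b"
    by (rule has_jet_prod) (use has_jet_lvar J_le in \<open>auto, blast\<close>)
  then obtain a' b' where "has_jet (lmon (chart_monomial k J)) a' b'"
    unfolding lmon_chart_monomial by blast
  from has_jet_mult[OF 1 this] show ?thesis
    unfolding dehomogenize(2)[OF e, symmetric] by blast
qed

end

end

section \<open>Two points of a product of lines\<close>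

text \<open>\<open>A\<close> is the set of factors whose linear form vanishes at \<open>p\<close>;
  in the others it vanishes at \<open>q\<close>. The orders of vanishing at the two points are
  therefore the cardinalities of \<open>A\<close> and of its complement.\<close>

definition tensor :: "nat \<Rightarrow> (nat \<Rightarrow> nat \<Rightarrow> 'a::field) \<Rightarrow> (nat \<Rightarrow> nat \<Rightarrow> 'a) \<Rightarrow> nat set \<Rightarrow> 'a laurent" where
  "tensor k x y A = (\<Prod>i<k. if i \<in> A then lform x y i else lform y x i)"

lemma tensor_swap: "tensor k y x A = tensor k x y ({..<k} - A)"
  unfolding tensor_def by (rule prod.cong) auto

lemma tensor_in_twist_sections:
  fixes x y :: "nat \<Rightarrow> nat \<Rightarrow> 'a::field"
  assumes "\<And>i. i < k \<Longrightarrow> n i = 1"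
  shows "tensor k x y A \<in> twist_sections k n 1 T"
proof -
  \<comment> \<open>The coefficients of \<open>lform\<close>, abstracted over both vectors because
    the factors use \<open>lform x y\<close> as well as \<open>lform y x\<close>.\<close>
  define a where "a = (\<lambda>(x :: nat \<Rightarrow> nat \<Rightarrow> 'a) (y :: nat \<Rightarrow> nat \<Rightarrow> 'a) i. x i 0 / (x i 0 * y i 1 - x i 1 * y i 0) :: 'a)"
  define b where "b = (\<lambda>(x :: nat \<Rightarrow> nat \<Rightarrow> 'a) (y :: nat \<Rightarrow> nat \<Rightarrow> 'a) i. - x i 1 / (x i 0 * y i 1 - x i 1 * y i 0) :: 'a)"
  show ?thesis
    unfolding tensor_def
    by (rule prod_linear_in_twist_sections[where a = "\<lambda>i. if i \<in> A then a x y i else a y x i"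
          and b = "\<lambda>i. if i \<in> A then b x y i else b y x i"])
      (use assms in \<open>auto simp: lform_def a_def b_def\<close>)
qed

section \<open>The tensors as a basis adapted to the jets at both points\<close>

context two_points
begin

text \<open>A linear form on a line is determined by its values at \<open>x i\<close> and
  \<open>y i\<close>; the two forms take the values 0, 1 and 1, 0 there, so these values are the
  coefficients.\<close>

lemma lvar_eq_lforms:
  assumes i: "i < k" and j: "j \<le> 1"
  shows "lvar i j = lconst (y i j) * lform x y i + lconst (x i j) * lform y x i"
proof -
  define d where "d = x i 0 * y i 1 - x i 1 * y i 0"
  have d: "d \<noteq> 0" "y i 0 * x i 1 - y i 1 * x i 0 = - d"
    using det[OF i] by (auto simp: d_def algebra_simps)
  have *: "y i j * (x i 0 / d) + x i j * (y i 0 / - d) = (y i j * x i 0 - x i j * y i 0) / d"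
    "y i j * (- x i 1 / d) + x i j * (- y i 1 / - d) = (x i j * y i 1 - y i j * x i 1) / d"
    by (simp_all add: diff_divide_distrib)
  have "lconst (y i j) * lform x y i + lconst (x i j) * lform y x i =
     lconst (y i j * (x i 0 / d) + x i j * (y i 0 / - d)) * lvar i 1 +
     lconst (y i j * (- x i 1 / d) + x i j * (- y i 1 / - d)) * lvar i 0"
    unfolding lform_def d d_def[symmetric] single_add
    by (simp add: distrib_left distrib_right mult_single mult.assoc[symmetric] add_ac)
  also have "\<dots> = lvar i j"
    unfolding * using j d(1) by (cases "j = 0") (auto simp: le_Suc_eq d_def mult.commute)
  finally show ?thesis by simp
qed

lemma ev_tensor:
  assumes c: "admissible c" and A: "A \<subseteq> {..<k}"
  shows "ev c (tensor k x y A) = (\<Prod>i\<in>A. fls_const (c i) * fls_X)"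
proof -
  have "ev c (tensor k x y A) = (\<Prod>i<k. if i \<in> A then fls_const (c i) * fls_X else 1)"
    unfolding tensor_def ev_prod[OF c] by (rule prod.cong) (auto simp: ev_lform[OF c])
  also have "\<dots> = (\<Prod>i\<in>{..<k} \<inter> A. fls_const (c i) * fls_X)"
    by (simp add: prod.inter_restrict)
  finally show ?thesis using A by (simp add: Int_absorb1)
qed

lemma double_zero_tensor:
  assumes A: "A \<subseteq> {..<k}" and card: "card A \<ge> 2"
  shows "double_zero (tensor k x y A)"
  unfolding double_zero_def
proof (intro allI impI)
  fix c assume c: "admissible c"
  have "vanish_order (int (card A) * 1) (\<Prod>i\<in>A. fls_const (c i) * fls_X)"
    using A by (intro vanish_order_prod vanish_order_scale vanish_order_X) (auto intro: finite_subset)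
  then show "vanish_order 2 (ev c (tensor k x y A))"
    unfolding ev_tensor[OF c A] using card by (rule_tac vanish_order_mono) auto
qed

text \<open>The tensors with at most one element in \<open>A\<close> form a dual basis for the jets
  at \<open>p\<close>; all others have jet 0.\<close>

lemma has_jet_tensor:
  assumes A: "A \<subseteq> {..<k}"
  shows "has_jet (tensor k x y A) (if A = {} then 1 else 0) (\<lambda>i. if A = {i} then 1 else 0)"
proof -
  consider "A = {}" | i where "A = {i}" | "card A \<ge> 2"
  proof -
    have "finite A" using A finite_subset by blast
    moreover have "card A = 0 \<or> card A = 1 \<or> card A \<ge> 2" by linarith
    ultimately show thesis using that card_1_singletonE by (metis card_0_eq)
  qed
  then show ?thesis
  proof cases
    case 1
    then show ?thesis by (simp add: has_jet_def ev_tensor)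
  next
    case (2 i)
    have "(\<Sum>i'<k. c i' * (if i = i' then 1 else 0)) = c i" for c :: "nat \<Rightarrow> 'a"
      using A 2 by (simp add: if_distrib cong: if_cong)
    then show ?thesis using 2 A by (simp add: has_jet_def ev_tensor)
  next
    case 3
    then have "A \<noteq> {}" "\<And>i. A \<noteq> {i}" by auto
    then show ?thesis using double_zero_tensor[OF A 3] by (simp add: has_jet_0_iff)
  qed
qed

lemma in_open_pair: "in_open k {J, J'} p \<longleftrightarrow> in_open k {J} p \<and> in_open k {J'} p"
  by (auto simp: in_open_iff)

text \<open>
  The witness is a combination of the \<open>tensor k x y A\<close> with \<open>card A \<le> 1\<close>, hence vanishes to order
  at least \<open>k - 1\<close> at \<open>q\<close>.
\<close>

lemma global_section_with_jet:
  assumes k: "k \<ge> 3"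
  shows "\<exists>s. (\<forall>T. s \<in> twist_sections k n 1 T) \<and> two_points.double_zero k y x s \<and> has_jet s a b"
proof -
  interpret sw: two_points k n q p y x by (rule swap)
  define s where "s = lconst a * tensor k x y {} + (\<Sum>i<k. lconst (b i) * tensor k x y {i})"
  have t: "tensor k x y A \<in> twist_sections k n 1 T" for A T
    by (rule tensor_in_twist_sections) (rule n)
  have "s \<in> twist_sections k n 1 T" for T
    unfolding s_def by (intro twist_sections_add twist_sections_sum twist_sections_scale t)
  moreover have "sw.double_zero s"
  proof -
    have dz: "sw.double_zero (lconst a' * tensor k x y A)" if "A \<subseteq> {..<k}" "card A \<le> 1" for A a'
    proof -
      \<comment> \<open>At \<open>q\<close> the complement counts. It has at least two elements
        because \<open>k \<ge> 3\<close>.\<close>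
      have "card ({..<k} - A) = k - card A"
        using that by (simp add: card_Diff_subset finite_subset)
      then have "sw.double_zero (tensor k y x ({..<k} - A))"
        using that k by (intro sw.double_zero_tensor) auto
      then have "sw.double_zero (tensor k x y A)"
        using that by (simp add: tensor_swap[of k y x] double_diff)
      then show ?thesis
        by (auto simp: sw.double_zero_def sw.ev_mult fls_eval_lconst intro: vanish_order_scale)
    qed
    \<comment> \<open>A double zero is a zero jet, so closure of double zeros under finite sums
      comes from \<open>has_jet_sum\<close>.\<close>
    have "sw.has_jet (\<Sum>i<k. lconst (b i) * tensor k x y {i}) (\<Sum>i<k. 0) (\<lambda>j. \<Sum>i<k. 0)"
      by (rule sw.has_jet_sum) (auto simp: sw.has_jet_0_iff intro: dz)
    then have "sw.double_zero (\<Sum>i<k. lconst (b i) * tensor k x y {i})"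
      by (simp add: sw.has_jet_0_iff)
    then show ?thesis
      unfolding s_def by (intro sw.double_zero_add dz) auto
  qed
  moreover have "has_jet s a b"
    unfolding has_jet_def
  proof (intro allI impI)
    fix c assume c: "admissible c"
    have "ev c s = fls_const a + (\<Sum>i<k. fls_const (b i) * (fls_const (c i) * fls_X))"
      by (simp add: s_def fls_eval_add fls_eval_sum ev_mult[OF c] fls_eval_lconst ev_tensor[OF c])
    also have "(\<Sum>i<k. fls_const (b i) * (fls_const (c i) * fls_X)) = (\<Sum>i<k. fls_const (c i * b i)) * fls_X"
      unfolding sum_distrib_right
      by (rule sum.cong) (auto simp: mult_ac simp flip: fls_const_mult_const)
    also have "(\<Sum>i<k. fls_const (c i * b i)) = fls_const (\<Sum>i<k. c i * b i)"
      by (induction k) (auto simp flip: fls_plus_const)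
    finally show "vanish_order 2 (ev c s - (fls_const a + fls_const (\<Sum>i<k. c i * b i) * fls_X))"
      by simp
  qed
  ultimately show ?thesis by blast
qed

section \<open>Vanishing of h^1 for at least three factors\<close>

lemma correct_cochain:
  assumes k: "k \<ge> 3"
    and e: "\<And>J. J \<in> charts k n \<Longrightarrow> e J \<in> twist_sections k n 1 {J}"
    and ee: "\<And>J J'. J \<in> charts k n \<Longrightarrow> J' \<in> charts k n \<Longrightarrow> in_open k {J, J'} p \<Longrightarrow> double_zero (e J' - e J)"
  shows "\<exists>s. (\<forall>T. s \<in> twist_sections k n 1 T) \<and> two_points.double_zero k y x s \<and>
    (\<forall>J\<in>charts k n. in_open k {J} p \<longrightarrow> double_zero (e J - s))"
proof -
  \<comment> \<open>One reference chart is enough: by \<open>ee\<close>, all \<open>e J\<close> on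
    charts through \<open>p\<close> have the jet of \<open>e J0\<close>.\<close>
  obtain J0 where J0: "J0 \<in> charts k n" "in_open k {J0} p" using exists_chart by blast
  obtain a b where ab: "has_jet (e J0) a b" using has_jet_section[OF J0 e[OF J0(1)]] by blast
  obtain s where s: "\<forall>T. s \<in> twist_sections k n 1 T" "two_points.double_zero k y x s" "has_jet s a b"
    using global_section_with_jet[OF k] by blast
  have "double_zero (e J0 - s)"
    unfolding double_zero_def
  proof (intro allI impI)
    fix c assume c: "admissible c"
    let ?j = "fls_const a + fls_const (\<Sum>i<k. c i * b i) * fls_X"
    have "vanish_order 2 ((ev c (e J0) - ?j) - (ev c s - ?j))"
      by (rule vanish_order_diff) (use ab s(3) c in \<open>auto simp: has_jet_def\<close>)
    then show "vanish_order 2 (ev c (e J0 - s))" by (simp add: fls_eval_diff)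
  qed
  moreover have "double_zero (e J - e J0)" if "J \<in> charts k n" "in_open k {J} p" for J
    using ee J0 that in_open_pair by blast
  ultimately have "double_zero ((e J - e J0) + (e J0 - s))" if "J \<in> charts k n" "in_open k {J} p" for J
    using that double_zero_add by blast
  then show ?thesis using s by auto
qed

text \<open>Treats all charts alike: on a chart that misses \<open>p\<close> the ideal imposes no
  condition.\<close>

lemma section_in_ideal_square:
  assumes J: "J \<in> charts k n" and e: "e \<in> twist_sections k n 1 {J}"
    and dz: "in_open k {J} p \<Longrightarrow> double_zero e"
  shows "e * lmon (- chart_monomial k J) \<in> ideal_square k n p {J}"
proof (cases "in_open k {J} p")
  case True
  then show ?thesis by (intro double_zero_imp_ideal_square[OF J True e] dz)
next
  case False
  have "J i \<le> n i" if "i < k" for i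
    using J that PiE_mem[of J "{..<k}" "\<lambda>i. {..n i}" i] by (simp add: charts_def)
  then have "lmon (- chart_monomial k J) \<in> (twist_sections k n (- 1) {J} :: 'a laurent set)"
    by (intro single_in_twist_sections twist_chart_monomial)
  from twist_sections_mult[OF e this] show ?thesis
    using False by (intro ideal_square_not_in_open) simp_all
qed

theorem terracini_defect_eq_0:
  assumes k: "k \<ge> 3"
  shows "terracini_defect k n {p, q} = 0"
  unfolding terracini_defect_def
proof (rule coh_dim_eq_0, rule subsetI)
  interpret sw: two_points k n q p y x by (rule swap)
  let ?F = "twisted_ideal k n {p, q}"
  fix c assume c: "c \<in> cocycles k n ?F 1"
  have cF: "c [J, J'] \<in> ?F {J, J'}" if "J \<in> charts k n" "J' \<in> charts k n" for J J'
  proof -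
    have "[J, J'] \<in> chart_tuples k n 1" using that by (simp add: chart_tuples_def)
    then have "c [J, J'] \<in> ?F (set [J, J'])"
      using c unfolding cocycles_def cochains_def by blast
    then show ?thesis by simp
  qed
  have "\<exists>e. (\<forall>J\<in>charts k n. e J \<in> twist_sections k n 1 {J}) \<and>
      (\<forall>J\<in>charts k n. \<forall>J'\<in>charts k n. c [J, J'] = e J' - e J)"
  proof (rule cocycle_twist_sections_bounds)
    show "c [J, J'] \<in> twist_sections k n 1 {J, J'}" if "J \<in> charts k n" "J' \<in> charts k n" for J J'
      by (rule subsetD[OF twisted_ideal_subset cF[OF that]])
    show "c [J', J''] = c [J, J''] - c [J, J']"
      if "J \<in> charts k n" "J' \<in> charts k n" "J'' \<in> charts k n" for J J' J''
      by (rule cocycle_1_apply[OF c that])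
  qed simp
  then obtain e where e: "\<And>J. J \<in> charts k n \<Longrightarrow> e J \<in> twist_sections k n 1 {J}"
    and ce: "\<And>J J'. J \<in> charts k n \<Longrightarrow> J' \<in> charts k n \<Longrightarrow> c [J, J'] = e J' - e J"
    by (elim exE conjE) metis
  have "double_zero (e J' - e J)" if "J \<in> charts k n" "J' \<in> charts k n" "in_open k {J, J'} p" for J J'
    using double_zero_twisted_ideal[OF cF[OF that(1,2)]] that by (simp add: ce)
  then obtain s where s: "\<forall>T. s \<in> twist_sections k n 1 T" "sw.double_zero s"
    "\<forall>J\<in>charts k n. in_open k {J} p \<longrightarrow> double_zero (e J - s)"
    using correct_cochain[OF k e] by blast
  have "sw.double_zero (e J' - e J)" if "J \<in> charts k n" "J' \<in> charts k n" "in_open k {J, J'} q" for J J'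
    using sw.double_zero_twisted_ideal[OF cF[OF that(1,2)]] that by (simp add: ce)
  then obtain s' where s': "\<forall>T. s' \<in> twist_sections k n 1 T" "double_zero s'"
    "\<forall>J\<in>charts k n. in_open k {J} q \<longrightarrow> sw.double_zero (e J - s')"
    using sw.correct_cochain[OF k e] by blast
  \<comment> \<open>A global correction leaves the differences unchanged. At \<open>p\<close> the
    jet is removed by \<open>s\<close> while \<open>s'\<close> has a double zero, and conversely at
    \<open>q\<close>.\<close>
  define E where "E = (\<lambda>J. e J - (s + s'))"
  have E: "E J \<in> twist_sections k n 1 {J}" if "J \<in> charts k n" for J
    unfolding E_def using e[OF that] s(1) s'(1) by (blast intro: twist_sections_diff twist_sections_add)
  have Ep: "double_zero (E J)" if "J \<in> charts k n" "in_open k {J} p" for J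
  proof -
    have "double_zero ((e J - s) - s')" using s s' that by (blast intro: double_zero_diff)
    then show ?thesis by (simp add: E_def diff_diff_add)
  qed
  have Eq: "sw.double_zero (E J)" if "J \<in> charts k n" "in_open k {J} q" for J
  proof -
    have "sw.double_zero ((e J - s') - s)" using s s' that by (blast intro: sw.double_zero_diff)
    then show ?thesis by (simp add: E_def diff_diff_add add.commute)
  qed
  show "c \<in> coboundaries k n ?F 1"
  proof (rule coboundariesI)
    show "c \<in> cochains k n ?F 1" using c by (simp add: cocycles_def)
    fix J assume J: "J \<in> charts k n"
    \<comment> \<open>\<open>twisted_ideal\<close> consists of sums of products, so
      \<open>E J\<close> is written as a function in the ideal times the generator of O(1, ...,
      1).\<close>
    let ?g = "E J * lmon (- chart_monomial k J)"
    have "?g \<in> ideal_square k n p {J}" "?g \<in> ideal_square k n q {J}"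
      by (rule section_in_ideal_square[OF J E[OF J] Ep[OF J]], assumption,
          rule sw.section_in_ideal_square[OF J E[OF J] Eq[OF J]], assumption)
    then have "?g \<in> double_points_ideal k n {p, q} {J}"
      using ideal_square_subset[of k n p "{J}"] by (auto simp: double_points_ideal_def)
    moreover have "lmon (chart_monomial k J) \<in> twist_sections k n 1 {J}"
      using J by (intro single_in_twist_sections twist_chart_monomial) (auto simp: charts_def)
    ultimately have "?g * lmon (chart_monomial k J) \<in> ?F {J}"
      unfolding twisted_ideal_def by (rule module_prod_mult)
    moreover have "?g * lmon (chart_monomial k J) = E J"
      by (simp add: mult.assoc mult_single)
    ultimately show "E J \<in> ?F {J}" by simp
  next
    fix J J' assume "J \<in> charts k n" "J' \<in> charts k n"
    then show "c [J, J'] = E J' - E J" by (simp add: ce E_def)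
  qed
qed

section \<open>Vanishing of h^0 for at most two factors\<close>

lemma global_section_tensors:
  assumes f: "\<And>J. J \<in> charts k n \<Longrightarrow> f \<in> twist_sections k n 1 {J}"
  shows "\<exists>a. f = (\<Sum>A\<in>Pow {..<k}. lconst (a A) * tensor k x y A)"
proof -
  \<comment> \<open>No variable is inverted on all charts, so \<open>m\<close> is a product of one
    variable per factor. Expressing each variable by the two linear forms and expanding gives the
    tensors.\<close>
  have mon: "\<exists>a. lmon m = (\<Sum>A\<in>Pow {..<k}. lconst (a A) * tensor k x y A)"
    if m: "m \<in> Poly_Mapping.keys f" for m
  proof -
    have tw: "twist_monomial k n 1 {J} m" if "J \<in> charts k n" for J
      using f[OF that] m by (simp add: twist_sections_iff)
    obtain J0 where "J0 \<in> charts k n" using exists_chart by blast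
    from tw[OF this] have keys: "Poly_Mapping.keys m \<subseteq> {(i, j). i < k \<and> j \<le> n i}"
      and sum: "\<And>i. i < k \<Longrightarrow> Poly_Mapping.lookup m (i, 0) + Poly_Mapping.lookup m (i, 1) = 1"
      unfolding twist_monomial_def using n by (auto simp: atMost_1 simp flip: One_nat_def)
    have nn: "Poly_Mapping.lookup m (i, j) \<ge> 0" if "i < k" "j \<le> 1" for i j
    proof (rule ccontr)
      assume "\<not> ?thesis"
      \<comment> \<open>On the chart with index \<open>1 - j\<close> in every factor, the variable
        \<open>x (i, j)\<close> is not inverted.\<close>
      moreover have "(\<lambda>i\<in>{..<k}. 1 - j) \<in> charts k n"
        using n by (auto simp: charts_def)
      from tw[OF this] have "Poly_Mapping.lookup m (i, j) < 0 \<longrightarrow> (\<exists>J\<in>{\<lambda>i\<in>{..<k}. 1 - j}. j = J i)"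
        unfolding twist_monomial_def by blast
      then have "Poly_Mapping.lookup m (i, j) < 0 \<longrightarrow> j = 1 - j" using that by simp
      ultimately show False using that by presburger
    qed
    \<comment> \<open>Two nonnegative exponents with sum 1: \<open>J\<close> selects the variable
      that occurs.\<close>
    define J where "J = (\<lambda>i. if Poly_Mapping.lookup m (i, 1) = 1 then 1 else 0 :: nat)"
    have "m = chart_monomial k J"
    proof (rule poly_mapping_eqI)
      fix v :: "nat \<times> nat"
      obtain i j where v: "v = (i, j)" by fastforce
      show "Poly_Mapping.lookup m v = Poly_Mapping.lookup (chart_monomial k J) v"
      proof (cases "i < k \<and> j \<le> 1")
        case True
        then have "j = 0 \<or> j = 1" "Poly_Mapping.lookup m (i, 0) \<ge> 0" "Poly_Mapping.lookup m (i, 1) \<ge> 0"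
          using nn by auto
        then show ?thesis
          using True sum[of i] by (auto simp: v lookup_chart_monomial J_def)
      next
        case False
        then have "v \<notin> Poly_Mapping.keys m" using keys n by (auto simp: v)
        then show ?thesis using False by (auto simp: v lookup_chart_monomial J_def in_keys_iff)
      qed
    qed
    then have "lmon m = (\<Prod>i<k. lvar i (J i) :: 'a laurent)"
      by (simp add: lmon_chart_monomial)
    also have "\<dots> = (\<Prod>i<k. lconst (y i (J i)) * lform x y i + lconst (x i (J i)) * lform y x i)"
      by (rule prod.cong[OF refl], rule lvar_eq_lforms) (auto simp: J_def)
    also have "\<dots> = (\<Sum>A\<in>Pow {..<k}. (\<Prod>i\<in>A. lconst (y i (J i)) * lform x y i) *
        (\<Prod>i\<in>{..<k} - A. lconst (x i (J i)) * lform y x i))"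
      by (rule prod_add) simp
    also have "\<dots> = (\<Sum>A\<in>Pow {..<k}. lconst ((\<Prod>i\<in>A. y i (J i)) * (\<Prod>i\<in>{..<k} - A. x i (J i))) * tensor k x y A)"
    proof (rule sum.cong[OF refl])
      fix A assume "A \<in> Pow {..<k}"
      then have A: "A \<subseteq> {..<k}" by simp
      have lprod: "(\<Prod>i\<in>X. lconst (h i)) = lconst (\<Prod>i\<in>X. h i :: 'a)" for X :: "nat set" and h
        by (induction X rule: infinite_finite_induct) (auto simp: mult_single)
      have "tensor k x y A = (\<Prod>i\<in>A. lform x y i) * (\<Prod>i\<in>{..<k} - A. lform y x i)"
        unfolding tensor_def using A prod.subset_diff[of A "{..<k}" "\<lambda>i. if i \<in> A then lform x y i else lform y x i"]
        by (simp add: mult.commute)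
      then show "(\<Prod>i\<in>A. lconst (y i (J i)) * lform x y i) * (\<Prod>i\<in>{..<k} - A. lconst (x i (J i)) * lform y x i) =
          lconst ((\<Prod>i\<in>A. y i (J i)) * (\<Prod>i\<in>{..<k} - A. x i (J i))) * tensor k x y A"
        using mult_single[of 0 "\<Prod>i\<in>A. y i (J i)" "0 :: (nat \<times> nat) \<Rightarrow>\<^sub>0 int" "\<Prod>i\<in>{..<k} - A. x i (J i)"]
        by (simp add: prod.distrib lprod mult_ac)
    qed
    finally show ?thesis
      by (rule exI[of _ "\<lambda>A. (\<Prod>i\<in>A. y i (J i)) * (\<Prod>i\<in>{..<k} - A. x i (J i))"])
  qed
  have "\<forall>m\<in>Poly_Mapping.keys f. \<exists>a. lmon m = (\<Sum>A\<in>Pow {..<k}. lconst (a A) * tensor k x y A)"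
    by (rule ballI) (rule mon)
  from bchoice[OF this] obtain a where a: "\<And>m. m \<in> Poly_Mapping.keys f \<Longrightarrow>
      lmon m = (\<Sum>A\<in>Pow {..<k}. lconst (a m A) * tensor k x y A)"
    by (elim exE) simp
  have "f = (\<Sum>m\<in>Poly_Mapping.keys f. Poly_Mapping.single m (Poly_Mapping.lookup f m))"
    by (rule laurent_eq_sum)
  also have "\<dots> = (\<Sum>m\<in>Poly_Mapping.keys f. \<Sum>A\<in>Pow {..<k}. lconst (Poly_Mapping.lookup f m * a m A) * tensor k x y A)"
  proof (rule sum.cong[OF refl])
    fix m assume m: "m \<in> Poly_Mapping.keys f"
    have "Poly_Mapping.single m (Poly_Mapping.lookup f m) = lconst (Poly_Mapping.lookup f m) * lmon m"
      by (simp add: mult_single)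
    then show "Poly_Mapping.single m (Poly_Mapping.lookup f m) = (\<Sum>A\<in>Pow {..<k}. lconst (Poly_Mapping.lookup f m * a m A) * tensor k x y A)"
      unfolding a[OF m] by (simp add: sum_distrib_left mult.assoc[symmetric] mult_single)
  qed
  also have "\<dots> = (\<Sum>A\<in>Pow {..<k}. \<Sum>m\<in>Poly_Mapping.keys f. lconst (Poly_Mapping.lookup f m * a m A) * tensor k x y A)"
    by (rule sum.swap)
  also have "\<dots> = (\<Sum>A\<in>Pow {..<k}. lconst (\<Sum>m\<in>Poly_Mapping.keys f. Poly_Mapping.lookup f m * a m A) * tensor k x y A)"
  proof (rule sum.cong[OF refl])
    fix A
    have lsum: "lconst (\<Sum>i\<in>X. h i :: 'a) = (\<Sum>i\<in>X. lconst (h i))" for X :: "((nat \<times> nat) \<Rightarrow>\<^sub>0 int) set" and h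
      by (induction X rule: infinite_finite_induct) (auto simp: single_add)
    show "(\<Sum>m\<in>Poly_Mapping.keys f. lconst (Poly_Mapping.lookup f m * a m A) * tensor k x y A) =
        lconst (\<Sum>m\<in>Poly_Mapping.keys f. Poly_Mapping.lookup f m * a m A) * tensor k x y A"
      unfolding lsum sum_distrib_right ..
  qed
  finally show ?thesis
    by (rule exI[of _ "\<lambda>A. \<Sum>m\<in>Poly_Mapping.keys f. Poly_Mapping.lookup f m * a m A"])
qed

text \<open>By \<open>has_jet_tensor\<close>, \<open>a {}\<close> is the value and the
  \<open>a {i}\<close> are the slopes of the jet of the sum.\<close>

lemma double_zero_tensor_coeffs:
  assumes dz: "double_zero (\<Sum>A\<in>Pow {..<k}. lconst (a A) * tensor k x y A)"
  shows "a {} = 0" "i < k \<Longrightarrow> a {i} = 0"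
proof -
  have 1: "has_jet (lconst (a A) * tensor k x y A) (if A = {} then a A else 0) (\<lambda>i. if A = {i} then a A else 0)"
    if "A \<subseteq> {..<k}" for A
  proof -
    have "has_jet (lconst (a A) * tensor k x y A) (a A * (if A = {} then 1 else 0))
        (\<lambda>i. a A * (if A = {i} then 1 else 0) + (if A = {} then 1 else 0) * 0)"
      by (rule has_jet_mult[OF has_jet_lconst has_jet_tensor[OF that]])
    moreover have "(\<lambda>i. a A * (if A = {i} then 1 else 0) + (if A = {} then 1 else 0) * 0) =
        (\<lambda>i. if A = {i} then a A else 0)"
      by auto
    moreover have "a A * (if A = {} then 1 else 0) = (if A = {} then a A else 0)" by simp
    ultimately show ?thesis by (simp only:)
  qed
  have 2: "has_jet (\<Sum>A\<in>Pow {..<k}. lconst (a A) * tensor k x y A) (\<Sum>A\<in>Pow {..<k}. if A = {} then a A else 0)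
      (\<lambda>i. \<Sum>A\<in>Pow {..<k}. if A = {i} then a A else 0)"
    by (rule has_jet_sum) (use 1 in auto)
  from jet_double_zero(1)[OF 2 dz] show "a {} = 0" by simp
  show "a {i} = 0" if "i < k"
    using jet_double_zero(2)[OF 2 dz that] that by simp
qed

theorem twisted_ideal_no_sections:
  assumes k: "k \<le> 2"
  shows "coh_dim k n (twisted_ideal k n {p, q}) 0 = 0"
proof (rule coh_dim_eq_0, rule subsetI)
  interpret sw: two_points k n q p y x by (rule swap)
  let ?F = "twisted_ideal k n {p, q}"
  fix c assume c: "c \<in> cocycles k n ?F 0"
  obtain J0 where J0: "J0 \<in> charts k n" "in_open k {J0} p" using exists_chart by blast
  obtain J1 where J1: "J1 \<in> charts k n" "in_open k {J1} q" using sw.exists_chart by blast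
  \<comment> \<open>A 0-cocycle takes the same value on all charts, so it is one global
    section.\<close>
  define f where "f = c [J0]"
  have cf: "c [J] = f" if "J \<in> charts k n" for J
  proof -
    have "coboundary k n 0 c [J0, J] = 0" using c unfolding cocycles_def by auto
    then show ?thesis using coboundary_0_apply[OF J0(1) that, of c] by (simp add: f_def)
  qed
  have cF: "f \<in> ?F {J}" if "J \<in> charts k n" for J
  proof -
    have "[J] \<in> chart_tuples k n 0" using that by (simp add: chart_tuples_def)
    then have "c [J] \<in> ?F (set [J])"
      using c unfolding cocycles_def cochains_def by blast
    then show ?thesis by (simp add: cf[OF that])
  qed
  obtain a where a: "f = (\<Sum>A\<in>Pow {..<k}. lconst (a A) * tensor k x y A)"
    using global_section_tensors[of f] cF twisted_ideal_subset by blast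
  have "double_zero f"
    by (rule double_zero_twisted_ideal[OF cF[OF J0(1)] _ J0(2)]) simp
  then have a0: "a {} = 0" and a1: "\<And>i. i < k \<Longrightarrow> a {i} = 0"
    unfolding a by (rule double_zero_tensor_coeffs)+
  \<comment> \<open>Exchanging the points complements the index sets, so the empty set at
    \<open>q\<close> stands for the coefficient of the full set.\<close>
  have "f = (\<Sum>A\<in>Pow {..<k}. lconst (a ({..<k} - A)) * tensor k y x A)"
    unfolding a
    by (rule sum.reindex_bij_witness[where i = "\<lambda>A. {..<k} - A" and j = "\<lambda>A. {..<k} - A"])
      (auto simp: tensor_swap[of k y x] double_diff)
  moreover have "sw.double_zero f"
    by (rule sw.double_zero_twisted_ideal[OF cF[OF J1(1)] _ J1(2)]) simp
  ultimately have a2: "a {..<k} = 0"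
    using sw.double_zero_tensor_coeffs(1)[of "\<lambda>A. a ({..<k} - A)"] by simp
  have "a A = 0" if A: "A \<subseteq> {..<k}" for A
  proof -
    have fin: "finite A" using A finite_subset by blast
    have "card A \<le> k" using card_mono[OF _ A] by simp
    \<comment> \<open>With at most two factors every \<open>A\<close> is empty, a singleton or full;
      the first two cases are settled at \<open>p\<close>, the last at \<open>q\<close>.\<close>
    then consider "card A = 0" | "card A = 1" | "card A = card {..<k}" using k by force
    then show ?thesis
    proof cases
      case 1
      then show ?thesis using fin a0 by simp
    next
      case 2
      then obtain i where "A = {i}" by (rule card_1_singletonE)
      then show ?thesis using A a1 by simp
    next
      case 3
      then show ?thesis using card_subset_eq[OF _ A] a2 by simp
    qed
  qed
  then have f0: "f = 0" unfolding a by (intro sum.neutral) auto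
  have "c Js = 0" for Js
  proof (cases "Js \<in> chart_tuples k n 0")
    case True
    then show ?thesis using cf f0 by (auto simp: chart_tuples_def length_Suc_conv)
  next
    case False
    then show ?thesis using c by (simp add: cocycles_def cochains_def)
  qed
  then show "c \<in> coboundaries k n ?F 0" by (simp add: fun_eq_iff)
qed

end

section \<open>Minimality\<close>

lemma span_two_rays_subset:
  fixes x y :: "nat \<Rightarrow> 'a::field"
  assumes "\<And>v. v \<in> P \<Longrightarrow> \<exists>c. v = vec_scale c x" "\<And>v. v \<in> Q \<Longrightarrow> \<exists>c. v = vec_scale c y"
  shows "module.span vec_scale (P \<union> Q) \<subseteq> {\<lambda>j. a * x j + b * y j | a b. True}"
proof -
  interpret vs: vector_space "vec_scale :: 'a \<Rightarrow> _" by (rule vector_space_vec_scale)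
  let ?V = "{\<lambda>j. a * x j + b * y j | a b. True}"
  have in_V: "(\<lambda>j. a * x j + b * y j) \<in> ?V" for a b by blast
  show ?thesis
  proof (rule vs.span_minimal)
    show "P \<union> Q \<subseteq> ?V"
    proof
      fix v assume "v \<in> P \<union> Q"
      then consider c where "v = vec_scale c x" | c where "v = vec_scale c y" using assms by blast
      then show "v \<in> ?V"
      proof cases
        case (1 c)
        then show ?thesis using in_V[of c 0] by (simp add: vec_scale_def)
      next
        case (2 c)
        then show ?thesis using in_V[of 0 c] by (simp add: vec_scale_def)
      qed
    qed
    show "vs.subspace ?V"
    proof (rule vs.subspaceI)
      show "0 \<in> ?V" using in_V[of 0 0] by (simp add: zero_fun_def)
    next
      fix u v assume "u \<in> ?V" "v \<in> ?V"
      then obtain a b a' b' where "u = (\<lambda>j. a * x j + b * y j)" "v = (\<lambda>j. a' * x j + b' * y j)" by blast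
      then have "u + v = (\<lambda>j. (a + a') * x j + (b + b') * y j)"
        by (simp add: fun_eq_iff algebra_simps)
      then show "u + v \<in> ?V" using in_V by simp
    next
      fix c v assume "v \<in> ?V"
      then obtain a b where "v = (\<lambda>j. a * x j + b * y j)" by blast
      then have "vec_scale c v = (\<lambda>j. (c * a) * x j + (c * b) * y j)"
        by (simp add: vec_scale_def fun_eq_iff algebra_simps)
      then show "vec_scale c v \<in> ?V" using in_V by simp
    qed
  qed
qed

lemma proj_space_rep:
  assumes "P \<in> proj_space m"
  shows "\<exists>x. x \<in> P \<and> (\<forall>v\<in>P. \<exists>c. c \<noteq> 0 \<and> v = vec_scale c x)"
proof -
  obtain x where x: "x \<in> coord_space m - {0}" "P = proj_rel m `` {x}"
    using assms unfolding proj_space_def by (auto elim!: quotientE)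
  have "(x, x) \<in> proj_rel m"
    using x(1) unfolding proj_rel_def by (auto simp: vec_scale_def intro!: exI[of _ 1])
  then show ?thesis using x(2) unfolding proj_rel_def by (intro exI[of _ x]) auto
qed

text \<open>All unit vectors lie in the plane of \<open>x\<close> and \<open>y\<close>. Two of them
  force the determinant to be nonzero, and a third would be one too many.\<close>

lemma two_points_span_line:
  fixes x y :: "nat \<Rightarrow> 'a::field"
  assumes m: "m > 0" and span: "proj_span m {P, Q} = proj_space m"
    and x: "\<And>v. v \<in> P \<Longrightarrow> \<exists>c. v = vec_scale c x" and y: "\<And>v. v \<in> Q \<Longrightarrow> \<exists>c. v = vec_scale c y"
  shows "m = 1" "x 0 * y 1 - x 1 * y 0 \<noteq> 0"
proof -
  define u :: "nat \<Rightarrow> nat \<Rightarrow> 'a" where "u = (\<lambda>l j. if j = l then 1 else 0)"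
  have "\<exists>a b. u l = (\<lambda>j. a * x j + b * y j)" if "l \<le> m" for l
  proof -
    have "u l l \<noteq> (0 :: nat \<Rightarrow> 'a) l" by (simp add: u_def)
    then have "u l \<noteq> 0" by metis
    moreover have "u l \<in> coord_space m" using that by (simp add: coord_space_def u_def)
    ultimately have u: "u l \<in> coord_space m - {0}" by simp
    then have "proj_rel m `` {u l} \<in> proj_space m" unfolding proj_space_def by (rule quotientI)
    then have "proj_rel m `` {u l} \<in> proj_span m {P, Q}" by (simp add: span)
    then have "proj_rel m `` {u l} \<subseteq> module.span vec_scale (P \<union> Q)" by (simp add: proj_span_def)
    moreover have "u l \<in> proj_rel m `` {u l}"
      using u unfolding proj_rel_def by (auto simp: vec_scale_def intro!: exI[of _ 1])
    ultimately have "u l \<in> {\<lambda>j. a * x j + b * y j | a b. True}"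
      using span_two_rays_subset[of P x Q y, OF x y] by blast
    then show ?thesis by blast
  qed
  then obtain a b where ab: "\<And>l j. l \<le> m \<Longrightarrow> u l j = a l * x j + b l * y j" by metis
  \<comment> \<open>Multiplicativity of the determinant, for the first two unit vectors expressed by
    \<open>x\<close> and \<open>y\<close>.\<close>
  have "(a 0 * b 1 - a 1 * b 0) * (x 0 * y 1 - x 1 * y 0) = u 0 0 * u 1 1 - u 0 1 * u 1 0"
    using m by (simp add: ab algebra_simps)
  also have "\<dots> = 1" by (simp add: u_def)
  finally show det: "x 0 * y 1 - x 1 * y 0 \<noteq> 0" by auto
  show "m = 1"
  proof (rule ccontr)
    assume "m \<noteq> 1"
    then have m2: "2 \<le> m" using m by simp
    have 0: "a 2 * x 0 + b 2 * y 0 = 0" and 1: "a 2 * x 1 + b 2 * y 1 = 0" and 2: "a 2 * x 2 + b 2 * y 2 = 1"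
      using ab[OF m2, of 0] ab[OF m2, of 1] ab[OF m2, of 2] by (auto simp: u_def)
    \<comment> \<open>Cramer's rule: the third unit vector is zero at indices 0 and 1, so both of
      its coefficients vanish.\<close>
    have "a 2 * (x 0 * y 1 - x 1 * y 0) = (a 2 * x 0 + b 2 * y 0) * y 1 - (a 2 * x 1 + b 2 * y 1) * y 0"
      by (simp add: algebra_simps)
    moreover have "b 2 * (x 0 * y 1 - x 1 * y 0) = (a 2 * x 1 + b 2 * y 1) * x 0 - (a 2 * x 0 + b 2 * y 0) * x 1"
      by (simp add: algebra_simps)
    ultimately have "a 2 = 0" "b 2 = 0" using det unfolding 0 1 by simp_all
    then show False using 2 by simp
  qed
qed

lemma minimal_two_points:
  fixes p q :: "'a::field_char_0 mpoint"
  assumes n: "\<And>i. i < k \<Longrightarrow> n i > 0" and pq: "p \<in> multiproj k n" "q \<in> multiproj k n"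
    and min: "minimal_multiproj k n {p, q}"
  shows "\<exists>x y. two_points k n p q x y"
proof -
  have "\<forall>i. \<exists>x. i < k \<longrightarrow> x \<in> r i \<and> (\<forall>v\<in>r i. \<exists>c. c \<noteq> 0 \<and> v = vec_scale c x)" if "r \<in> multiproj k n" for r :: "'a mpoint"
    using that proj_space_rep unfolding multiproj_def by (metis PiE_mem lessThan_iff)
  from choice[OF this[OF pq(1)]] choice[OF this[OF pq(2)]] obtain x y where
    x: "\<And>i. i < k \<Longrightarrow> x i \<in> p i \<and> (\<forall>v\<in>p i. \<exists>c. c \<noteq> 0 \<and> v = vec_scale c (x i))" and
    y: "\<And>i. i < k \<Longrightarrow> y i \<in> q i \<and> (\<forall>v\<in>q i. \<exists>c. c \<noteq> 0 \<and> v = vec_scale c (y i))"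
    by blast
  have span: "proj_span (n i) {p i, q i} = proj_space (n i)" if "i < k" for i
    using min that unfolding minimal_multiproj_def multiproj_proj_def by simp
  have "n i = 1 \<and> x i 0 * y i 1 - x i 1 * y i 0 \<noteq> 0" if "i < k" for i
    using two_points_span_line[OF n[OF that] span[OF that], of "x i" "y i"] x[OF that] y[OF that] by blast
  then have "two_points k n p q x y"
    using x y by unfold_locales auto
  then show ?thesis by blast
qed

theorem proposition1p8:
  fixes k :: nat and n :: "nat \<Rightarrow> nat"
  assumes "k \<ge> 1" and "\<And>i. i < k \<Longrightarrow> n i > 0"
  shows "terracini_locus k n 2 = ({} :: 'a::{alg_closed_field, field_char_0} mpoint set set)"
proof (rule ccontr)
  assume "terracini_locus k n 2 \<noteq> ({} :: 'a mpoint set set)"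
  then obtain S :: "'a mpoint set" where S: "S \<subseteq> multiproj k n" "card S = 2"
    "coh_dim k n (twisted_ideal k n S) 0 > 0" "terracini_defect k n S > 0" "minimal_multiproj k n S"
    unfolding terracini_locus_def terracini_locus1_def by auto
  obtain p q where pq: "S = {p, q}" using S(2) by (auto simp: card_2_iff)
  then have "p \<in> multiproj k n" "q \<in> multiproj k n" "minimal_multiproj k n {p, q}"
    using S(1,5) by simp_all
  from minimal_two_points[OF assms(2) this] obtain x y where "two_points k n p q x y" by blast
  then interpret two_points k n p q x y .
  show False
  proof (cases "k \<le> 2")
    case True
    then show ?thesis using twisted_ideal_no_sections S(3) pq by simp
  next
    case False
    then show ?thesis using terracini_defect_eq_0 S(4) pq by simp
  qed
qed

end
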